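(* Let $q$ be a complex number with $|q|<1$, with a fixed choice of $q^{1/2}$. Let $k\geq 1$ and $1\le i\le k+1$ be integers. Then $$\sum_{m,n_1,\dots,n_k\ge 0}\frac{q^{\frac{1}{2}m^2+mn_k+(N_1^2+N_2^2+\cdots+N_k^2)+N_i+N_{i+1}+\cdots+N_k}}{(q;q)_{m}(q;q)_{n_1}\cdots(q;q)_{n_{k-1}}(q^2;q^2)_{n_k}} = \frac{(-q^{\frac{1}{2}};q)_\infty(q^{i},q^{\frac{3}{2}+2k-i},q^{\frac{3}{2}+2k};q^{\frac{3}{2}+2k})_\infty}{(q;q)_\infty},$$ where $N_j=n_j+n_{j+1}+\cdots+n_k$ for $1\le j\le k$ and $N_j=0$ for $j>k$ (so for $i=k+1$ the linear part $N_i+\cdots+N_k$ in the exponent is $0$).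
   Context: For $|q|<1$: $(a;q)_\infty=\prod_{m=0}^\infty(1-aq^m)$, $(a;q)_n=(a;q)_\infty/(aq^n;q)_\infty=\prod_{m=0}^{n-1}(1-aq^m)$ for integers $n\ge0$, and $(a_1,\dots,a_r;q)_\infty=(a_1;q)_\infty\cdots(a_r;q)_\infty$; the same notation is used with the base $q$ replaced by another power of $q$. Half-integer powers of $q$ are understood as integer powers of the fixed square root $q^{1/2}$. *)

theory Defs
  imports "HOL-Analysis.Analysis"
begin

definition qpochhammer_inf :: "complex \<Rightarrow> complex \<Rightarrow> complex" where
  "qpochhammer_inf a q = (\<Prod>m. 1 - a * q ^ m)"

definition qpochhammer :: "complex \<Rightarrow> complex \<Rightarrow> nat \<Rightarrow> complex" where
  "qpochhammer a q n = (\<Prod>m<n. 1 - a * q ^ m)"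

text \<open>
  For \<open>n = (n\<^sub>1, \<dots>, n\<^sub>k)\<close>, the partial sum \<open>N\<^sub>j = n\<^sub>j + \<dots> + n\<^sub>k\<close>;
  it is \<open>0\<close> for \<open>j > k\<close>.
\<close>
definition tail_sum :: "nat \<Rightarrow> (nat \<Rightarrow> nat) \<Rightarrow> nat \<Rightarrow> nat" where
  "tail_sum k n j = (\<Sum>l=j..k. n l)"

text \<open>
  The summand. Here \<open>r\<close> is the chosen square root of \<open>q\<close>, so that
  \<open>q\<^bsup>m\<^sup>2/2\<^esup>\<close> is \<open>r ^ m\<^sup>2\<close>.
\<close>
definition summand ::
  "complex \<Rightarrow> complex \<Rightarrow> nat \<Rightarrow> nat \<Rightarrow> nat \<Rightarrow> (nat \<Rightarrow> nat) \<Rightarrow> complex" where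
  "summand q r k i m n =
     r ^ (m\<^sup>2) * q ^ (m * n k + (\<Sum>j=1..k. (tail_sum k n j)\<^sup>2) + (\<Sum>j=i..k. tail_sum k n j)) /
     (qpochhammer q q m * (\<Prod>j=1..<k. qpochhammer q q (n j)) * qpochhammer (q\<^sup>2) (q\<^sup>2) (n k))"

end

theory Submission
  imports Defs
begin

text \<open>
  Put \<open>r = q\<^bsup>1/2\<^esup>\<close>. Summing over \<open>m\<close> first, Euler's series gives
  \<open>(-r q\<^bsup>n\<^sub>k\<^esup>; q)\<^sub>\<infinity> = (-r; q)\<^sub>\<infinity> / (-r; q)\<^bsub>n\<^sub>k\<^esub>\<close>
  (\<open>euler_q_exponential\<close>). Up to the constant factor \<open>(-r; q)\<^sub>\<infinity>\<close>, what remains is a sum over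
  \<open>N\<^sub>1 \<ge> \<dots> \<ge> N\<^sub>k \<ge> 0\<close> in which the innermost variable carries
  \<open>\<beta>\<^sub>n = 1 / ((q\<^sup>2; q\<^sup>2)\<^sub>n (-r; q)\<^sub>n)\<close> and each summation
  applies the operation \<open>\<beta> \<mapsto> (N \<mapsto> \<Sum>\<^sub>s q\<^bsup>s\<^sup>2 + e s\<^esup> \<beta>\<^sub>s / (q; q)\<^bsub>N - s\<^esub>)\<close>, with
  \<open>e = 1\<close> on the levels \<open>j \<ge> i\<close> and \<open>e = 0\<close> on the levels \<open>j < i\<close>.

  Such sums are evaluated with Bailey pairs, written bilaterally as
  \<open>\<beta>\<^sub>n = \<Sum>\<^sub>m \<alpha>\<^sub>m / ((q; q)\<^bsub>n - m\<^esub> (q; q)\<^bsub>n + m + e\<^esub>)\<close> with \<open>m\<close> ranging over all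
  integers. By the q-Chu-Vandermonde sum the operation above multiplies \<open>\<alpha>\<^sub>m\<close> by
  \<open>q\<^bsup>m\<^sup>2 + e m\<^esup>\<close> (\<open>bailey_pair_step\<close>). The starting \<open>\<beta>\<close> belongs to
  \<open>\<alpha>\<^sub>m = (-1)\<^sup>m r\<^bsup>m(3m - 1)/2\<^esup>\<close> for \<open>e = 0\<close> (\<open>pentagonal_bailey_pair\<close>). The switch between
  \<open>e = 0\<close> and \<open>e = 1\<close>, needed once at the start and once when passing from level \<open>i\<close> to level
  \<open>i - 1\<close>, changes neither \<open>\<alpha>\<close> nor \<open>\<beta>\<close>, because \<open>\<alpha>\<^sub>m q\<^bsup>m + 1\<^esup>\<close> is odd under
  \<open>m \<mapsto> -1 - m\<close> (\<open>bailey_pair_change_parameter\<close>). This is how the linear part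
  \<open>N\<^sub>i + \<dots> + N\<^sub>k\<close> of the exponent shifts the resulting theta function.

  After all \<open>k\<close> levels the coefficients \<open>\<alpha>\<^sub>m\<close> are exactly those of the theta series, taken at
  index \<open>- m\<close>, with base \<open>q\<^bsup>3/2 + 2k\<^esup>\<close> and argument \<open>q\<^sup>i\<close> (\<open>pentagonal_coeff_eq_theta_coeff\<close>). Letting the outermost bound
  tend to infinity turns the kernel into the constant \<open>1 / (q; q)\<^sub>\<infinity>\<^sup>2\<close>, and the
  Jacobi triple product finishes the evaluation. The triple product is itself the limit of a
  Bailey pair (\<open>finite_jacobi_triple_product\<close>), so both limits use the same
  lemma \<open>tendsto_bailey_sum\<close>.
\<close>

section \<open>Sums and limits under a summable bound\<close>

text \<open>
  Tannery's theorem, obtained from dominated convergence for the counting measure. It justifies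
  each passage to the limit under a summation sign below.
\<close>
lemma dominated_convergence_infsum:
  fixes f :: "nat \<Rightarrow> 'a \<Rightarrow> complex"
  assumes h: "h summable_on A" and le: "\<And>N x. x \<in> A \<Longrightarrow> norm (f N x) \<le> h x"
    and lim: "\<And>x. x \<in> A \<Longrightarrow> (\<lambda>N. f N x) \<longlonglongrightarrow> g x"
  shows "g summable_on A" and "(\<lambda>N. infsum (f N) A) \<longlonglongrightarrow> infsum g A"
proof -
  have h0: "h x \<ge> 0" if "x \<in> A" for x
    using le[OF that, of 0] norm_ge_zero order_trans by blast
  have hint: "integrable (count_space A) h"
  proof -
    have "(\<lambda>x. norm (h x)) summable_on A"
      using h h0 by (subst summable_on_cong[where g=h]) auto
    then show ?thesis
      using abs_summable_equivalent abs_summable_on_def by blast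
  qed
  have meas: "g \<in> borel_measurable (count_space A)" "\<And>N. f N \<in> borel_measurable (count_space A)"
    by simp_all
  have ae: "AE x in count_space A. (\<lambda>N. f N x) \<longlonglongrightarrow> g x"
    "\<And>N. AE x in count_space A. norm (f N x) \<le> h x"
    using le lim by (auto simp: AE_count_space)
  note dom = integrable_dominated_convergence[OF meas hint ae]
    integrable_dominated_convergence2[OF meas hint ae] integral_dominated_convergence[OF meas hint ae]
  have "infsum (f N) A = integral\<^sup>L (count_space A) (f N)" for N
    using dom(2) by (simp add: infsetsum_infsum[symmetric] abs_summable_on_def infsetsum_def)
  moreover have "infsum g A = integral\<^sup>L (count_space A) g"
    using dom(1) by (simp add: infsetsum_infsum[symmetric] abs_summable_on_def infsetsum_def)
  ultimately show "(\<lambda>N. infsum (f N) A) \<longlonglongrightarrow> infsum g A"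
    using dom(3) by simp
  show "g summable_on A"
    using dom(1) abs_summable_equivalent abs_summable_on_def abs_summable_summable by blast
qed

lemma dominated_convergence_infsum_has_sum:
  fixes f :: "nat \<Rightarrow> 'a \<Rightarrow> complex"
  assumes h: "h summable_on A" and le: "\<And>N x. x \<in> A \<Longrightarrow> norm (f N x) \<le> h x"
    and lim: "\<And>x. x \<in> A \<Longrightarrow> (\<lambda>N. f N x) \<longlonglongrightarrow> g x"
    and S: "\<And>N. (f N has_sum S N) A" and L: "S \<longlonglongrightarrow> L"
  shows "(g has_sum L) A"
proof -
  have "g summable_on A" "(\<lambda>N. infsum (f N) A) \<longlonglongrightarrow> infsum g A"
    by (rule dominated_convergence_infsum[OF h le lim]; assumption)+
  moreover have "infsum (f N) A = S N" for N
    using S by (rule infsumI)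
  ultimately show ?thesis
    using L LIMSEQ_unique[of S] by (auto simp: has_sum_iff)
qed

lemma has_sum_sum_finite:
  fixes f :: "'a \<Rightarrow> 'b \<Rightarrow> 'c::topological_comm_monoid_add"
  assumes "finite I" "\<And>i. i \<in> I \<Longrightarrow> (f i has_sum S i) A"
  shows "((\<lambda>x. \<Sum>i\<in>I. f i x) has_sum (\<Sum>i\<in>I. S i)) A"
  using assms by (induction I) (auto intro!: has_sum_add)

lemma bounded_int_support_summable:
  fixes h :: "int \<Rightarrow> complex"
  assumes "\<And>m. \<bar>m\<bar> > B \<Longrightarrow> h m = 0"
  shows "h summable_on UNIV"
proof (rule finite_nonzero_values_imp_summable_on)
  have "{m \<in> UNIV. h m \<noteq> 0} \<subseteq> {-B..B}"
  proof
    fix m assume "m \<in> {m \<in> UNIV. h m \<noteq> 0}"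
    then have "\<not> \<bar>m\<bar> > B" using assms by blast
    then show "m \<in> {-B..B}" by auto
  qed
  then show "finite {m \<in> UNIV. h m \<noteq> 0}"
    using finite_subset by blast
qed

text \<open>
  The reflection \<open>m \<mapsto> c - m\<close> permutes the integers, so the sum equals its own negative. If \<open>h\<close> is
  not summable, the sum is \<open>0\<close> by the convention for \<open>infsum\<close>.
\<close>
lemma infsum_odd_reflection:
  fixes h :: "int \<Rightarrow> complex"
  assumes "\<And>m. h (c - m) = - h m"
  shows "infsum h UNIV = 0"
proof -
  have "infsum h UNIV = infsum (\<lambda>m. - h m) UNIV"
    by (rule infsum_reindex_bij_witness[of _ "\<lambda>m. c - m" "\<lambda>m. c - m"]) (auto simp: assms)
  then show ?thesis by (simp add: infsum_uminus)
qed

lemma has_sum_int_shift: "((\<lambda>m::int. f (m + c)) has_sum s) UNIV \<longleftrightarrow> (f has_sum s) UNIV"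
  by (rule has_sum_reindex_bij_witness[of _ "\<lambda>m. m - c" "\<lambda>m. m + c"]) auto

text \<open>
  The ratio of consecutive terms is \<open>x \<rho>\<^sup>n\<close>, which tends to \<open>0\<close>.
\<close>
lemma summable_power_choose_two:
  fixes x \<rho> :: real
  assumes "0 \<le> x" "0 \<le> \<rho>" "\<rho> < 1"
  shows "(\<lambda>n. x ^ n * \<rho> ^ (n choose 2)) summable_on UNIV"
proof -
  have "(\<lambda>n. x * \<rho> ^ n) \<longlonglongrightarrow> x * 0"
    using assms by (intro tendsto_intros LIMSEQ_power_zero) auto
  then have "eventually (\<lambda>n. x * \<rho> ^ n < 1 / 2) sequentially"
    by (rule order_tendstoD) auto
  then obtain K where K: "\<And>n. n \<ge> K \<Longrightarrow> x * \<rho> ^ n \<le> 1 / 2"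
    unfolding eventually_sequentially by (meson less_imp_le)
  have "summable (\<lambda>n. x ^ n * \<rho> ^ (n choose 2))"
  proof (rule summable_ratio_test[of "1 / 2" K])
    fix n assume "n \<ge> K"
    have "Suc n choose 2 = n + (n choose 2)"
      by (simp add: numeral_2_eq_2)
    then have "norm (x ^ Suc n * \<rho> ^ (Suc n choose 2)) = (x * \<rho> ^ n) * (x ^ n * \<rho> ^ (n choose 2))"
      using assms by (simp add: power_add mult_ac)
    also have "\<dots> \<le> 1 / 2 * (x ^ n * \<rho> ^ (n choose 2))"
      using assms K[OF \<open>n \<ge> K\<close>] by (intro mult_right_mono) auto
    finally show "norm (x ^ Suc n * \<rho> ^ (Suc n choose 2)) \<le> 1 / 2 * norm (x ^ n * \<rho> ^ (n choose 2))"
      using assms by simp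
  qed auto
  then show ?thesis
    using assms by (intro summable_nonneg_imp_summable_on) auto
qed

lemma summable_on_int_split:
  fixes f :: "int \<Rightarrow> real"
  assumes "(\<lambda>n. f (int n)) summable_on UNIV" "(\<lambda>n. f (- int n)) summable_on UNIV"
  shows "f summable_on UNIV"
proof -
  have "f summable_on range int"
    using assms(1) by (subst summable_on_reindex) (auto simp: o_def)
  moreover have "f summable_on range (\<lambda>n. - int n)"
    using assms(2) by (subst summable_on_reindex) (auto simp: o_def inj_def)
  ultimately have "f summable_on (range int \<union> range (\<lambda>n. - int n))"
    by (rule summable_on_union)
  moreover have "range int \<union> range (\<lambda>n. - int n) = UNIV"
    by (auto simp: image_iff) (metis int_cases2)
  ultimately show ?thesis by simp
qed

lemma geometric_dominated_summable:
  fixes a b :: real and k :: nat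
  assumes "0 \<le> a" "a < 1" "0 \<le> b" "b < 1"
  shows "(\<lambda>(m, n). a ^ m * (\<Prod>l=1..k. b ^ n l)) summable_on (UNIV \<times> ({1..k} \<rightarrow>\<^sub>E (UNIV :: nat set)))"
proof -
  have geo: "(\<lambda>m. x ^ m) summable_on UNIV" if "0 \<le> x" "x < 1" for x :: real
    using that by (intro summable_nonneg_imp_summable_on summable_geometric) auto
  have "Infinite_Set_Sum.abs_summable_on (\<lambda>m. b ^ m) UNIV"
    using assms geo[of b] by (simp flip: abs_summable_equivalent)
  then have "Infinite_Set_Sum.abs_summable_on (\<lambda>n. \<Prod>l\<in>{1..k}. b ^ n l) ({1..k} \<rightarrow>\<^sub>E (UNIV :: nat set))"
    by (intro abs_summable_on_prod_PiE) auto
  then have "(\<lambda>n. \<Prod>l=1..k. b ^ n l) summable_on ({1..k} \<rightarrow>\<^sub>E (UNIV :: nat set))"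
    using abs_summable_equivalent abs_summable_summable by blast
  then obtain P where P: "((\<lambda>n. \<Prod>l=1..k. b ^ n l) has_sum P) ({1..k} \<rightarrow>\<^sub>E (UNIV :: nat set))"
    by (auto simp: summable_on_def)
  show ?thesis
  proof (rule summable_on_SigmaI)
    show "((\<lambda>n. case (m, n) of (m, n) \<Rightarrow> a ^ m * (\<Prod>l=1..k. b ^ n l)) has_sum a ^ m * P) ({1..k} \<rightarrow>\<^sub>E UNIV)" for m
      using has_sum_cmult_right[OF P] by simp
    show "(\<lambda>m. a ^ m * P) summable_on UNIV"
      using assms by (intro summable_on_cmult_left geo)
  qed (use assms in \<open>auto intro!: mult_nonneg_nonneg prod_nonneg\<close>)
qed

section \<open>Reciprocal q-factorials and infinite q-products\<close>

text \<open>
  The convention \<open>1 / (q; q)\<^sub>j = 0\<close> for \<open>j < 0\<close> truncates all sums by itself and makes the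
  recurrence \<open>inv_qfact_pred\<close> valid for every integer index, so that no boundary terms appear.
\<close>
definition inv_qfact :: "complex \<Rightarrow> int \<Rightarrow> complex" where
  "inv_qfact q j = (if j < 0 then 0 else 1 / qpochhammer q q (nat j))"

lemma inv_qfact_neg: "j < 0 \<Longrightarrow> inv_qfact q j = 0"
  by (simp add: inv_qfact_def)

lemma inv_qfact_of_nat: "inv_qfact q (int n) = 1 / qpochhammer q q n"
  by (simp add: inv_qfact_def)

lemma qpochhammer_Suc: "qpochhammer a q (Suc n) = qpochhammer a q n * (1 - a * q ^ n)"
  by (simp add: qpochhammer_def)

lemma qpochhammer_0: "qpochhammer a q 0 = 1"
  by (simp add: qpochhammer_def)

lemma norm_power_lt_1:
  assumes "norm (q::complex) < 1"
  shows "norm (q ^ Suc n) < 1"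
proof -
  have "norm q * norm q ^ n \<le> norm q * 1"
    using assms by (intro mult_left_mono power_le_one) auto
  then show ?thesis
    using assms by (simp add: norm_mult norm_power)
qed

lemma one_minus_power_nonzero:
  fixes q :: complex
  assumes "norm q < 1" "n > 0"
  shows "1 - q ^ n \<noteq> 0"
  using norm_power_lt_1[OF assms(1), of "n - 1"] assms(2) by auto

lemma qpochhammer_tendsto:
  assumes "norm q < 1"
  shows "qpochhammer a q \<longlonglongrightarrow> qpochhammer_inf a q"
proof -
  have "summable (\<lambda>m. norm ((1 - a * q ^ m) - 1))"
    using assms by (simp add: norm_mult norm_power summable_geometric summable_mult)
  then have "convergent_prod (\<lambda>m. 1 - a * q ^ m)"
    by (intro abs_convergent_prod_imp_convergent_prod summable_imp_abs_convergent_prod)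
  then have "(\<lambda>n. \<Prod>m\<le>n. 1 - a * q ^ m) \<longlonglongrightarrow> qpochhammer_inf a q"
    unfolding qpochhammer_inf_def by (rule convergent_prod_LIMSEQ)
  then show ?thesis
    unfolding qpochhammer_def LIMSEQ_lessThan_iff_atMost .
qed

lemma qpochhammer_inf_nonzero:
  assumes "norm q < 1" and "\<And>m. a * q ^ m \<noteq> 1"
  shows "qpochhammer_inf a q \<noteq> 0"
proof -
  have "summable (\<lambda>m. norm ((1 - a * q ^ m) - 1))"
    using assms by (simp add: norm_mult norm_power summable_geometric summable_mult)
  then have "convergent_prod (\<lambda>m. 1 - a * q ^ m)"
    by (intro abs_convergent_prod_imp_convergent_prod summable_imp_abs_convergent_prod)
  then show ?thesis
    unfolding qpochhammer_inf_def using assms(2) by (intro prodinf_nonzero) auto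
qed

lemma qpochhammer_nonzero:
  assumes "\<And>m. a * q ^ m \<noteq> 1"
  shows "qpochhammer a q n \<noteq> 0"
  using assms unfolding qpochhammer_def by auto

lemma power_neq_1:
  fixes q :: complex
  assumes "norm q < 1"
  shows "q * q ^ m \<noteq> 1"
  using norm_power_lt_1[OF assms, of m] by (auto dest: arg_cong[where f=norm])

text \<open>
  With \<open>r = q\<^bsup>1/2\<^esup>\<close> this says that no factor of \<open>(-r; q)\<^sub>\<infinity>\<close> vanishes.
\<close>
lemma neg_mult_power_neq_1:
  fixes r :: complex
  assumes "norm r < 1" "norm q < 1"
  shows "- r * q ^ m \<noteq> 1"
proof -
  have "norm r * norm q ^ m \<le> norm r * 1"
    using assms by (intro mult_left_mono power_le_one) auto
  then have "norm (- r * q ^ m) < 1"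
    using assms by (simp add: norm_mult norm_power)
  then show ?thesis by (metis less_irrefl norm_one)
qed

context
  fixes q :: complex
  assumes q1: "norm q < 1"
begin

lemma qfact_nonzero: "qpochhammer q q n \<noteq> 0"
  by (intro qpochhammer_nonzero power_neq_1 q1)

lemma qfact_inf_nonzero: "qpochhammer_inf q q \<noteq> 0"
  by (intro qpochhammer_inf_nonzero power_neq_1 q1)

lemma inv_qfact_0: "inv_qfact q 0 = 1"
  by (simp add: inv_qfact_def qpochhammer_0)

lemma inv_qfact_pred: "inv_qfact q (j - 1) = (1 - q powi j) * inv_qfact q j"
proof (cases "j \<le> 0")
  case True
  then show ?thesis by (cases "j = 0") (auto simp: inv_qfact_def)
next
  case False
  then obtain n where j: "j = int (Suc n)"
    using zero_less_imp_eq_int[of j] by (metis not_le gr0_implies_Suc)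
  have "1 - q * q ^ n \<noteq> 0"
    using power_neq_1[OF q1, of n] by auto
  then show ?thesis
    using qfact_nonzero unfolding j power_int_of_nat
    by (simp add: inv_qfact_def qpochhammer_Suc nat_add_distrib)
qed

lemma inv_qfact_tendsto: "(\<lambda>n. inv_qfact q (int n + c)) \<longlonglongrightarrow> 1 / qpochhammer_inf q q"
proof -
  have 1: "(\<lambda>n. 1 / qpochhammer q q n) \<longlonglongrightarrow> 1 / qpochhammer_inf q q"
    by (intro tendsto_divide tendsto_const qpochhammer_tendsto q1 qfact_inf_nonzero)
  have "filterlim (\<lambda>n. nat (int n + c)) at_top sequentially"
    unfolding filterlim_at_top eventually_sequentially
  proof
    fix Z
    show "\<exists>N. \<forall>n\<ge>N. Z \<le> nat (int n + c)"
      by (rule exI[of _ "Z + nat (- c)"]) auto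
  qed
  from filterlim_compose[OF 1 this]
  have "(\<lambda>n. 1 / qpochhammer q q (nat (int n + c))) \<longlonglongrightarrow> 1 / qpochhammer_inf q q" .
  moreover have "eventually (\<lambda>n. 1 / qpochhammer q q (nat (int n + c)) = inv_qfact q (int n + c)) sequentially"
    unfolding eventually_sequentially
    by (rule exI[of _ "nat (- c)"]) (auto simp: inv_qfact_def)
  ultimately show ?thesis
    by (rule Lim_transform_eventually)
qed

lemma inv_qfact_bounded: obtains C where "C \<ge> 1" "\<And>j. norm (inv_qfact q j) \<le> C"
proof -
  have "Bseq (\<lambda>n. inv_qfact q (int n + 0))"
    using convergentI[OF inv_qfact_tendsto] by (rule convergent_imp_Bseq)
  then obtain K where K: "\<And>n. norm (inv_qfact q (int n)) \<le> K"
    unfolding Bseq_def by auto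
  have "norm (inv_qfact q j) \<le> max K 1" for j
    using K[of "nat j"] by (cases "j < 0") (auto simp: inv_qfact_neg)
  then show ?thesis by (intro that[of "max K 1"]) auto
qed

lemma qpochhammer_inf_split:
  "qpochhammer_inf a q = qpochhammer a q n * qpochhammer_inf (a * q ^ n) q"
proof (rule LIMSEQ_unique)
  show "(\<lambda>N. qpochhammer a q (N + n)) \<longlonglongrightarrow> qpochhammer_inf a q"
    using LIMSEQ_ignore_initial_segment[OF qpochhammer_tendsto[OF q1]] .
  have "qpochhammer a q (N + n) = qpochhammer a q n * qpochhammer (a * q ^ n) q N" for N
    by (induction N) (simp_all add: qpochhammer_0 qpochhammer_Suc power_add mult_ac)
  then show "(\<lambda>N. qpochhammer a q (N + n)) \<longlonglongrightarrow> qpochhammer a q n * qpochhammer_inf (a * q ^ n) q"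
    using qpochhammer_tendsto[OF q1] by (simp add: tendsto_mult_left)
qed

end

section \<open>Bailey pairs\<close>

lemma bailey_kernel_eq_0: "\<bar>m\<bar> > int n + int e \<Longrightarrow> inv_qfact q (int n - m) * inv_qfact q (int n + m + int e) = 0"
  by (cases "m > 0") (auto simp: inv_qfact_neg)

text \<open>
  A Bailey pair relative to \<open>a = q\<^sup>e\<close>, in bilateral form. The usual unilateral \<open>\<alpha>\<close> is recovered by
  adding the coefficients at \<open>m\<close> and \<open>- m - e\<close>, between which the kernel is symmetric; keeping
  them apart makes \<open>\<alpha>\<^sub>m\<close> a single signed monomial in the cases below.
\<close>
definition bailey_pair :: "complex \<Rightarrow> nat \<Rightarrow> (int \<Rightarrow> complex) \<Rightarrow> (nat \<Rightarrow> complex) \<Rightarrow> bool" where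
  "bailey_pair q e \<alpha> \<beta> \<longleftrightarrow>
     (\<forall>n. ((\<lambda>m. \<alpha> m * (inv_qfact q (int n - m) * inv_qfact q (int n + m + int e))) has_sum \<beta> n) UNIV)"

context
  fixes q :: complex
  assumes q1: "norm q < 1"
begin

text \<open>
  The limiting case of the q-Chu-Vandermonde sum in which one of the two upper parameters tends to
  infinity. The Pascal rule for \<open>1 / ((q; q)\<^bsub>M - t\<^esub> (q; q)\<^sub>t)\<close> turns the sum for \<open>M + 1\<close> and \<open>c\<close>
  into the one for \<open>M\<close> and \<open>c + 1\<close>, which is why \<open>c\<close> varies in the induction.
\<close>
lemma q_chu_vandermonde:
  "(\<Sum>t\<le>M. q ^ (t * (t + c)) * inv_qfact q (int M - int t) * inv_qfact q (int t) * inv_qfact q (int (t + c)))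
    = inv_qfact q (int M) * inv_qfact q (int (M + c))"
proof (induction M arbitrary: c)
  case 0
  show ?case by (simp add: inv_qfact_0[OF q1])
next
  case (Suc M)
  define u where "u = inv_qfact q"
  have split: "(1 - q ^ Suc M) * (u (int (Suc M) - int t) * u (int t))
      = q ^ t * u (int M - int t) * u (int t) + u (int (Suc M) - int t) * u (int t - 1)"
    if "t \<le> Suc M" for t
  proof -
    have "u (int M - int t) = (1 - q ^ (Suc M - t)) * u (int (Suc M) - int t)"
    proof -
      have "int (Suc M) - int t = int (Suc M - t)" "int M - int t = int (Suc M - t) - 1"
        using that by auto
      then show ?thesis
        using inv_qfact_pred[OF q1, of "int (Suc M - t)"] by (simp only: u_def power_int_of_nat)
    qed
    moreover have "u (int t - 1) = (1 - q ^ t) * u (int t)"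
      using inv_qfact_pred[OF q1, of "int t"] by (simp add: u_def power_int_of_nat)
    moreover have "q ^ Suc M = q ^ t * q ^ (Suc M - t)"
      using that by (simp flip: power_add)
    ultimately show ?thesis by (simp only:) (simp only: algebra_simps mult_1_left)
  qed
  have "(1 - q ^ Suc M) * (\<Sum>t\<le>Suc M. q ^ (t * (t + c)) * u (int (Suc M) - int t) * u (int t) * u (int (t + c)))
     = (\<Sum>t\<le>Suc M. q ^ (t * (t + c)) * ((1 - q ^ Suc M) * (u (int (Suc M) - int t) * u (int t))) * u (int (t + c)))"
    by (simp only: sum_distrib_left mult_ac)
  also have "\<dots> = (\<Sum>t\<le>Suc M. q ^ (t * (t + c)) * (q ^ t * u (int M - int t) * u (int t)
                    + u (int (Suc M) - int t) * u (int t - 1)) * u (int (t + c)))"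
    by (intro sum.cong refl) (simp only: split atMost_iff)
  also have "\<dots> = (\<Sum>t\<le>Suc M. q ^ (t * (t + c)) * q ^ t * u (int M - int t) * u (int t) * u (int (t + c)))
     + (\<Sum>t\<le>Suc M. q ^ (t * (t + c)) * u (int (Suc M) - int t) * u (int t - 1) * u (int (t + c)))"
    by (simp only: sum.distrib[symmetric]) (simp add: algebra_simps)
  also have "(\<Sum>t\<le>Suc M. q ^ (t * (t + c)) * q ^ t * u (int M - int t) * u (int t) * u (int (t + c)))
     = (\<Sum>t\<le>M. q ^ (t * (t + c)) * q ^ t * u (int M - int t) * u (int t) * u (int (t + c)))"
    by (simp add: u_def inv_qfact_neg)
  also have "(\<Sum>t\<le>Suc M. q ^ (t * (t + c)) * u (int (Suc M) - int t) * u (int t - 1) * u (int (t + c)))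
     = (\<Sum>t\<le>M. q ^ (Suc t * (Suc t + c)) * u (int M - int t) * u (int t) * u (int (t + Suc c)))"
    by (subst sum.atMost_Suc_shift) (simp add: u_def inv_qfact_neg)
  also have "(\<Sum>t\<le>M. q ^ (t * (t + c)) * q ^ t * u (int M - int t) * u (int t) * u (int (t + c))) + \<dots>
     = (\<Sum>t\<le>M. q ^ (t * (t + Suc c)) * u (int M - int t) * u (int t) * u (int (t + Suc c)))"
  proof (subst sum.distrib[symmetric], intro sum.cong refl)
    fix t
    have "u (int (t + c)) = (1 - q ^ (t + Suc c)) * u (int (t + Suc c))"
      using inv_qfact_pred[OF q1, of "int (t + Suc c)"]
      by (simp add: u_def power_int_of_nat del: power_Suc of_nat_Suc) (simp add: algebra_simps)
    moreover have "q ^ (Suc t * (Suc t + c)) = q ^ (t * (t + c)) * q ^ t * q ^ (t + Suc c)"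
      "q ^ (t * (t + Suc c)) = q ^ (t * (t + c)) * q ^ t"
      by (simp_all flip: power_add add: algebra_simps)
    ultimately show "q ^ (t * (t + c)) * q ^ t * u (int M - int t) * u (int t) * u (int (t + c)) +
         q ^ (Suc t * (Suc t + c)) * u (int M - int t) * u (int t) * u (int (t + Suc c)) =
         q ^ (t * (t + Suc c)) * u (int M - int t) * u (int t) * u (int (t + Suc c))"
      by (simp only:) (simp only: algebra_simps mult_1_left)
  qed
  also have "\<dots> = u (int M) * u (int (M + Suc c))"
    unfolding u_def by (rule Suc.IH)
  also have "u (int M) = (1 - q ^ Suc M) * u (int (Suc M))"
    using inv_qfact_pred[OF q1, of "int (Suc M)"] by (simp add: u_def power_int_of_nat del: power_Suc of_nat_Suc) simp
  finally show ?case
    using one_minus_power_nonzero[OF q1, of "Suc M"] by (simp add: u_def)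
qed

text \<open>
  For \<open>m \<ge> 0\<close> the nonzero terms have \<open>s = m + t\<close>, and the substitution gives the q-Chu-Vandermonde
  sum with \<open>c = 2m + e\<close>. Negative \<open>m\<close> reduce to this case by the symmetry \<open>m \<mapsto> - m - e\<close>. The
  restriction to \<open>e \<le> 1\<close> guarantees that one of \<open>m\<close> and \<open>- m - e\<close> is nonnegative.
\<close>
lemma bailey_kernel_sum:
  assumes e: "e \<le> (1::nat)"
  shows "(\<Sum>s\<le>N. q ^ (s\<^sup>2 + e * s) * inv_qfact q (int N - int s) * (inv_qfact q (int s - m) * inv_qfact q (int s + m + int e)))
    = q powi (m\<^sup>2 + int e * m) * (inv_qfact q (int N - m) * inv_qfact q (int N + m + int e))"
proof -
  define u where "u = inv_qfact q"
  have nonneg: "(\<Sum>s\<le>N. q ^ (s\<^sup>2 + e * s) * u (int N - int s) * (u (int s - int p) * u (int s + int p + int e)))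
    = q ^ (p\<^sup>2 + e * p) * (u (int N - int p) * u (int N + int p + int e))" for p
  proof (cases "p \<le> N")
    case False
    then show ?thesis by (simp add: u_def inv_qfact_neg)
  next
    case True
    have "(\<Sum>s\<le>N. q ^ (s\<^sup>2 + e * s) * u (int N - int s) * (u (int s - int p) * u (int s + int p + int e)))
      = (\<Sum>s\<in>{p..N}. q ^ (s\<^sup>2 + e * s) * u (int N - int s) * (u (int s - int p) * u (int s + int p + int e)))"
      by (rule sum.mono_neutral_right) (auto simp: u_def inv_qfact_neg)
    also have "\<dots> = (\<Sum>t\<le>N - p. q ^ ((p + t)\<^sup>2 + e * (p + t)) * u (int (N - p) - int t) * (u (int t) * u (int (t + (2 * p + e)))))"
      by (rule sum.reindex_bij_witness[of _ "\<lambda>t. p + t" "\<lambda>s. s - p"])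
        (use True in \<open>auto simp: of_nat_diff algebra_simps\<close>)
    also have "\<dots> = q ^ (p\<^sup>2 + e * p) * (\<Sum>t\<le>N - p. q ^ (t * (t + (2 * p + e))) * u (int (N - p) - int t) * u (int t) * u (int (t + (2 * p + e))))"
      unfolding sum_distrib_left
    proof (intro sum.cong refl)
      fix t
      have "q ^ ((p + t)\<^sup>2 + e * (p + t)) = q ^ (p\<^sup>2 + e * p) * q ^ (t * (t + (2 * p + e)))"
        unfolding power_add[symmetric] by (rule arg_cong[where f = "(^) q"]) (simp add: algebra_simps power2_eq_square)
      then show "q ^ ((p + t)\<^sup>2 + e * (p + t)) * u (int (N - p) - int t) * (u (int t) * u (int (t + (2 * p + e)))) =
          q ^ (p\<^sup>2 + e * p) * (q ^ (t * (t + (2 * p + e))) * u (int (N - p) - int t) * u (int t) * u (int (t + (2 * p + e))))"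
        by (simp only: mult_ac)
    qed
    also have "\<dots> = q ^ (p\<^sup>2 + e * p) * (u (int (N - p)) * u (int ((N - p) + (2 * p + e))))"
      unfolding u_def by (simp only: q_chu_vandermonde)
    also have "int ((N - p) + (2 * p + e)) = int N + int p + int e"
      using True by auto
    also have "int (N - p) = int N - int p"
      using True by auto
    finally show ?thesis .
  qed
  show ?thesis
  proof (cases "m \<ge> 0")
    case True
    then obtain p where m: "m = int p" by (metis nonneg_int_cases)
    have "m\<^sup>2 + int e * m = int (p\<^sup>2 + e * p)" by (simp add: m)
    then show ?thesis
      using nonneg[of p] by (simp only: u_def m power_int_of_nat)
  next
    case False
    with e have "0 \<le> - m - int e" by linarith
    then obtain p where "- m - int e = int p"
      by (metis nonneg_int_cases)
    then have m: "m = - int p - int e" by simp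
    have "m\<^sup>2 + int e * m = int (p\<^sup>2 + e * p)" by (simp add: m power2_eq_square algebra_simps)
    moreover have "int s - m = int s + int p + int e" "int s + m + int e = int s - int p" for s
      by (simp_all add: m)
    ultimately show ?thesis
      using nonneg[of p] by (simp only: u_def power_int_of_nat mult.commute[of "inv_qfact q (_ - _)"])
  qed
qed

lemma bailey_pair_step:
  assumes e: "e \<le> 1" and b: "bailey_pair q e \<alpha> \<beta>"
  shows "bailey_pair q e (\<lambda>m. q powi (m\<^sup>2 + int e * m) * \<alpha> m)
           (\<lambda>N. \<Sum>s\<le>N. q ^ (s\<^sup>2 + e * s) * inv_qfact q (int N - int s) * \<beta> s)"
  unfolding bailey_pair_def
proof
  fix N
  have "((\<lambda>m. \<Sum>s\<le>N. q ^ (s\<^sup>2 + e * s) * inv_qfact q (int N - int s) *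
           (\<alpha> m * (inv_qfact q (int s - m) * inv_qfact q (int s + m + int e)))) has_sum
     (\<Sum>s\<le>N. q ^ (s\<^sup>2 + e * s) * inv_qfact q (int N - int s) * \<beta> s)) UNIV"
    using b unfolding bailey_pair_def by (intro has_sum_sum_finite has_sum_cmult_right) auto
  moreover have "(\<Sum>s\<le>N. q ^ (s\<^sup>2 + e * s) * inv_qfact q (int N - int s) *
           (\<alpha> m * (inv_qfact q (int s - m) * inv_qfact q (int s + m + int e))))
    = q powi (m\<^sup>2 + int e * m) * \<alpha> m * (inv_qfact q (int N - m) * inv_qfact q (int N + m + int e))" for m
  proof -
    have "(\<Sum>s\<le>N. q ^ (s\<^sup>2 + e * s) * inv_qfact q (int N - int s) *
           (\<alpha> m * (inv_qfact q (int s - m) * inv_qfact q (int s + m + int e))))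
       = \<alpha> m * (\<Sum>s\<le>N. q ^ (s\<^sup>2 + e * s) * inv_qfact q (int N - int s) *
           (inv_qfact q (int s - m) * inv_qfact q (int s + m + int e)))"
      by (simp add: sum_distrib_left mult_ac)
    then show ?thesis
      by (simp only: bailey_kernel_sum[OF e]) (simp only: mult_ac)
  qed
  ultimately show "((\<lambda>m. q powi (m\<^sup>2 + int e * m) * \<alpha> m * (inv_qfact q (int N - m) * inv_qfact q (int N + m + int e))) has_sum
     (\<Sum>s\<le>N. q ^ (s\<^sup>2 + e * s) * inv_qfact q (int N - int s) * \<beta> s)) UNIV"
    by simp
qed

text \<open>
  The kernel for \<open>e = 0\<close> is \<open>1 - q\<^bsup>n + m + 1\<^esup>\<close> times the kernel for \<open>e = 1\<close>. The latter is invariant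
  under \<open>m \<mapsto> -1 - m\<close>, while \<open>\<alpha>\<^sub>m q\<^bsup>m + 1\<^esup>\<close> changes sign, so the second term contributes nothing.
\<close>
lemma bailey_pair_change_parameter:
  assumes q0: "q \<noteq> 0" and odd: "\<And>m. \<alpha> (- 1 - m) = - (\<alpha> m * q powi (2 * m + 1))"
  shows "bailey_pair q 0 \<alpha> \<beta> \<longleftrightarrow> bailey_pair q 1 \<alpha> \<beta>"
proof -
  define y where "y n m = inv_qfact q (int n - m) * inv_qfact q (int n + m + 1)" for n m
  have x: "\<alpha> m * (inv_qfact q (int n - m) * inv_qfact q (int n + m))
     = \<alpha> m * y n m - q ^ n * (\<alpha> m * q powi (m + 1) * y n m)" for n m
  proof -
    have "inv_qfact q (int n + m) = (1 - q powi (int n + (m + 1))) * inv_qfact q (int n + m + 1)"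
      using inv_qfact_pred[OF q1, of "int n + m + 1"] by (simp add: add.assoc)
    moreover have "q powi (int n + (m + 1)) = q ^ n * q powi (m + 1)"
      using q0 by (simp add: power_int_add power_int_of_nat)
    ultimately show ?thesis
      unfolding y_def by (simp only:) (simp add: algebra_simps)
  qed
  have y0: "y n m = 0" if "\<bar>m\<bar> > int n + 1" for n m
    using bailey_kernel_eq_0[of n 1 m] that by (simp add: y_def)
  have s1: "(\<lambda>m. \<alpha> m * y n m) summable_on UNIV" for n
    by (rule bounded_int_support_summable[of "int n + 1"]) (simp add: y0)
  have "((\<lambda>m. \<alpha> m * q powi (m + 1) * y n m) has_sum 0) UNIV" for n
  proof -
    have "(\<lambda>m. \<alpha> m * q powi (m + 1) * y n m) summable_on UNIV"
      by (rule bounded_int_support_summable[of "int n + 1"]) (simp add: y0)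
    moreover have "infsum (\<lambda>m. \<alpha> m * q powi (m + 1) * y n m) UNIV = 0"
    proof (rule infsum_odd_reflection[of _ "- 1"])
      fix m
      have "y n (- 1 - m) = y n m" by (simp add: y_def algebra_simps)
      moreover have "q powi (2 * m + 1) * q powi ((- 1 - m) + 1) = q powi (m + 1)"
        using q0 by (simp flip: power_int_add)
      ultimately show "\<alpha> (- 1 - m) * q powi ((- 1 - m) + 1) * y n (- 1 - m) = - (\<alpha> m * q powi (m + 1) * y n m)"
        by (simp only: odd) (simp add: mult.assoc[symmetric])
    qed
    ultimately show ?thesis by (simp add: has_sum_iff)
  qed
  note zero0 = this
  have zero: "((\<lambda>m. - (q ^ n) * (\<alpha> m * q powi (m + 1) * y n m)) has_sum 0) UNIV" for n
    using has_sum_cmult_right[OF zero0, where c = "- (q ^ n)"] by simp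
  have "((\<lambda>m. \<alpha> m * y n m) has_sum b) UNIV \<longleftrightarrow>
     ((\<lambda>m. \<alpha> m * (inv_qfact q (int n - m) * inv_qfact q (int n + m))) has_sum b) UNIV" for n b
  proof -
    obtain b' where b': "((\<lambda>m. \<alpha> m * y n m) has_sum b') UNIV"
      using s1 by (auto simp: summable_on_def)
    from has_sum_add[OF b' zero[of n]]
    have "((\<lambda>m. \<alpha> m * (inv_qfact q (int n - m) * inv_qfact q (int n + m))) has_sum b') UNIV"
      unfolding x by simp
    with b' show ?thesis by (auto dest: has_sum_unique)
  qed
  then show ?thesis
    unfolding bailey_pair_def by (simp add: y_def)
qed

end

section \<open>The Bailey pair with pentagonal exponents\<close>

lemma minus_one_powi_uminus: "(- 1 :: complex) powi (- m) = (- 1) powi m"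
proof -
  have "(- 1 :: complex) powi (- m) = inverse (- 1) powi m"
    by (simp only: power_int_minus power_int_inverse)
  also have "inverse (- 1 :: complex) = - 1" by simp
  finally show ?thesis .
qed

text \<open>
  The summands of Euler's pentagonal number series in \<open>r\<close>.
\<close>
definition pentagonal_coeff :: "complex \<Rightarrow> int \<Rightarrow> complex" where
  "pentagonal_coeff r m = (- 1) powi m * r powi ((3 * m\<^sup>2 - m) div 2)"

text \<open>
  What takes the place of \<open>1 / (q\<^sup>2; q\<^sup>2)\<^sub>n\<close> in the multiple sum once \<open>m\<close> has been summed out.
\<close>
definition pentagonal_beta :: "complex \<Rightarrow> complex \<Rightarrow> nat \<Rightarrow> complex" where
  "pentagonal_beta q r n = 1 / (qpochhammer (q\<^sup>2) (q\<^sup>2) n * qpochhammer (- r) q n)"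

lemma pentagonal_coeff_uminus:
  assumes "r \<noteq> 0"
  shows "pentagonal_coeff r (- m) = pentagonal_coeff r m * r powi m"
proof -
  have "(3 * (- m)\<^sup>2 - (- m)) = (3 * m\<^sup>2 - m) + m * 2"
    by simp
  then have "(3 * (- m)\<^sup>2 - (- m)) div 2 = (3 * m\<^sup>2 - m) div 2 + m"
    by (metis div_mult_self1_is_m div_mult_self1 add.commute zero_neq_numeral)
  then show ?thesis
    using assms by (simp add: pentagonal_coeff_def power_int_add minus_one_powi_uminus)
qed

lemma pentagonal_coeff_reflect:
  assumes "r \<noteq> 0"
  shows "pentagonal_coeff r (- 1 - m) = - (pentagonal_coeff r m * r powi (4 * m + 2))"
proof -
  have "(3 * (- 1 - m)\<^sup>2 - (- 1 - m)) = (3 * m\<^sup>2 - m) + (4 * m + 2) * 2"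
    by (simp add: power2_eq_square algebra_simps)
  then have "(3 * (- 1 - m)\<^sup>2 - (- 1 - m)) div 2 = (3 * m\<^sup>2 - m) div 2 + (4 * m + 2)"
    by (metis div_mult_self1 add.commute zero_neq_numeral)
  moreover have "(- 1 :: complex) powi (- 1 - m) = - ((- 1) powi m)"
    using power_int_add[of "- 1 :: complex" "- 1" "- m"] minus_one_powi_uminus by simp
  ultimately show ?thesis
    using assms by (simp add: pentagonal_coeff_def power_int_add)
qed

context
  fixes q r :: complex
  assumes q1: "norm q < 1" and r2: "r\<^sup>2 = q" and r0: "r \<noteq> 0"
begin

lemma q_powi_eq: "q powi m = r powi (2 * m)"
  using r2 by (simp add: power_int_mult)

text \<open>
  With \<open>F m\<close> the summand of \<open>S (n + 1)\<close> and \<open>Q = r\<^bsup>n + 1\<^esup>\<close>, consider the moments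
  \<open>M j = \<Sum>\<^sub>m F m r\<^bsup>j m\<^esup>\<close>. The summand of \<open>S n\<close> is
  \<open>F m (1 - Q\<^sup>2 r\<^bsup>2m\<^esup>) (1 - Q\<^sup>2 r\<^bsup>- 2m\<^esup>)\<close>, so \<open>S n\<close> is a combination of \<open>M 0\<close>, \<open>M 2\<close> and \<open>M (- 2)\<close>.
  The reflection \<open>m \<mapsto> - m\<close> gives \<open>M j = M (1 - j)\<close>. Two further relations come from the
  reflection \<open>m \<mapsto> -1 - m\<close>, under which \<open>H m = (1 - Q\<^sup>2 r\<^bsup>- 2m\<^esup>) F m\<close> is odd up to a power
  of \<open>r\<close>. Together they express everything through \<open>M 0 = S (n + 1)\<close>.
\<close>
lemma pentagonal_sum_rec:
  fixes S :: "nat \<Rightarrow> complex"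
  defines "S \<equiv> (\<lambda>n. \<Sum>\<^sub>\<infinity>m. pentagonal_coeff r m * (inv_qfact q (int n - m) * inv_qfact q (int n + m)))"
  shows "S n = (1 + r * q ^ n) * (1 - q ^ (2 * Suc n)) * S (Suc n)"
proof -
  define Q where "Q = r ^ Suc n"
  have qn: "q ^ Suc n = Q\<^sup>2"
    by (metis Q_def mult.commute power_mult r2)
  define F where "F m = pentagonal_coeff r m * (inv_qfact q (int (Suc n) - m) * inv_qfact q (int (Suc n) + m))" for m
  define M where "M j = (\<Sum>\<^sub>\<infinity>m. F m * r powi (j * m))" for j :: int
  have F_sum: "(\<lambda>m. F m * c m) summable_on UNIV" for c
    by (rule bounded_int_support_summable[of "int (Suc n)"])
      (use bailey_kernel_eq_0[of "Suc n" 0] in \<open>simp add: F_def\<close>)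
  have M: "((\<lambda>m. F m * r powi (j * m)) has_sum M j) UNIV" for j
    unfolding M_def by (intro has_sum_infsum F_sum)
  have M_sym: "M j = M (1 - j)" for j
    unfolding M_def
  proof (rule infsum_reindex_bij_witness[of _ uminus uminus])
    fix m
    have "r powi m * r powi ((1 - j) * - m) = r powi (j * m)"
      using r0 by (simp flip: power_int_add add: algebra_simps)
    then show "F (- m) * r powi ((1 - j) * - m) = F m * r powi (j * m)"
      using r0 by (simp add: F_def pentagonal_coeff_uminus mult_ac)
  qed auto
  define H where "H m = pentagonal_coeff r m * (inv_qfact q (int n - m) * inv_qfact q (int (Suc n) + m))" for m
  have H_reflect: "H (- 1 - m) = - (H m * r powi (4 * m + 2))" for m
    using r0 by (simp add: H_def pentagonal_coeff_reflect algebra_simps)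
  have pred1: "inv_qfact q (int n - m) = (1 - Q\<^sup>2 * r powi (- 2 * m)) * inv_qfact q (int (Suc n) - m)" for m
  proof -
    have "q powi (int (Suc n) - m) = Q\<^sup>2 * r powi (- 2 * m)"
    proof -
      have "q \<noteq> 0" using r0 r2 by auto
      then have "q powi (int (Suc n) + - m) = q powi (int (Suc n)) * q powi (- m)"
        by (intro power_int_add) auto
      also have "q powi (int (Suc n)) = Q\<^sup>2"
        by (simp only: power_int_of_nat qn)
      also have "q powi (- m) = r powi (- 2 * m)"
        by (simp add: q_powi_eq)
      finally show ?thesis by simp
    qed
    then show ?thesis
      using inv_qfact_pred[OF q1, of "int (Suc n) - m"] by simp
  qed
  have pred2: "inv_qfact q (int n + m) = (1 - Q\<^sup>2 * r powi (2 * m)) * inv_qfact q (int (Suc n) + m)" for m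
    using pred1[of "- m"] by simp
  have H_F: "H m = F m - Q\<^sup>2 * (F m * r powi (- 2 * m))" for m
    unfolding H_def F_def pred1 by (simp add: algebra_simps)
  have step: "pentagonal_coeff r m * (inv_qfact q (int n - m) * inv_qfact q (int n + m))
    = (1 + Q ^ 4) * (F m * r powi (0 * m)) + (- Q\<^sup>2 * (F m * r powi (2 * m)) + - Q\<^sup>2 * (F m * r powi (- 2 * m)))" for m
  proof -
    have "r powi (- 2 * m) * r powi (2 * m) = 1"
      using r0 by (simp flip: power_int_add)
    then show ?thesis
      unfolding F_def pred1 pred2 by simp algebra
  qed
  have S_M: "S n = (1 + Q ^ 4) * M 0 + (- Q\<^sup>2 * M 2 + - Q\<^sup>2 * M (- 2))"
    unfolding S_def step by (intro infsumI has_sum_add has_sum_cmult_right M)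
  \<comment> \<open>The antisymmetry of \<open>H m r\<^bsup>2m\<^esup>\<close>.\<close>
  have zero1: "M 2 - Q\<^sup>2 * M 0 = 0"
  proof -
    have "((\<lambda>m. F m * r powi (2 * m) + - Q\<^sup>2 * (F m * r powi (0 * m))) has_sum (M 2 + - Q\<^sup>2 * M 0)) UNIV"
      by (intro has_sum_add has_sum_cmult_right M)
    moreover have "F m * r powi (2 * m) + - Q\<^sup>2 * (F m * r powi (0 * m)) = H m * r powi (2 * m)" for m
    proof -
      have "r powi (- 2 * m) * r powi (2 * m) = 1"
        using r0 by (simp flip: power_int_add)
      then show ?thesis
        unfolding H_F by simp algebra
    qed
    moreover have "infsum (\<lambda>m. H m * r powi (2 * m)) UNIV = 0"
    proof (rule infsum_odd_reflection[of _ "- 1"])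
      fix m
      have "r powi (4 * m + 2) * r powi (2 * (- 1 - m)) = r powi (2 * m)"
        using r0 by (simp flip: power_int_add)
      then show "H (- 1 - m) * r powi (2 * (- 1 - m)) = - (H m * r powi (2 * m))"
        unfolding H_reflect by (metis mult.assoc mult_minus_left)
    qed
    ultimately show ?thesis
      by (simp add: has_sum_iff)
  qed
  \<comment> \<open>The antisymmetry of \<open>H m (r\<^sup>m + r\<^bsup>3m + 1\<^esup>)\<close>, whose two terms are exchanged by the reflection.\<close>
  have zero2: "M 1 + r * M 3 - Q\<^sup>2 * M (- 1) - r * Q\<^sup>2 * M 1 = 0"
  proof -
    have "((\<lambda>m. F m * r powi (1 * m) + (r * (F m * r powi (3 * m)) + (- Q\<^sup>2 * (F m * r powi (- 1 * m)) + - (r * Q\<^sup>2) * (F m * r powi (1 * m)))))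
        has_sum (M 1 + (r * M 3 + (- Q\<^sup>2 * M (- 1) + - (r * Q\<^sup>2) * M 1)))) UNIV"
      by (intro has_sum_add has_sum_cmult_right M)
    moreover have "F m * r powi (1 * m) + (r * (F m * r powi (3 * m)) + (- Q\<^sup>2 * (F m * r powi (- 1 * m)) + - (r * Q\<^sup>2) * (F m * r powi (1 * m))))
       = H m * (r powi m + r powi (3 * m + 1))" for m
    proof -
      have distrib: "(x - y * (x * c)) * (a + b * r)
          = x * a + (r * (x * b) + (- y * (x * (c * a)) + - (r * y) * (x * (c * b))))" for x y a b c :: complex
        by (simp add: algebra_simps)
      have "r powi (- 2 * m) * r powi m = r powi (- 1 * m)" "r powi (- 2 * m) * r powi (3 * m) = r powi m"
        using r0 by (simp_all flip: power_int_add)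
      moreover have "r powi (3 * m + 1) = r powi (3 * m) * r"
        by (rule power_int_add_1) (use r0 in simp)
      ultimately show ?thesis
        by (simp only: H_F distrib mult_1_left)
    qed
    moreover have "infsum (\<lambda>m. H m * (r powi m + r powi (3 * m + 1))) UNIV = 0"
    proof (rule infsum_odd_reflection[of _ "- 1"])
      fix m
      have "r powi (4 * m + 2) * r powi (- 1 - m) = r powi (3 * m + 1)"
        "r powi (4 * m + 2) * r powi (3 * (- 1 - m) + 1) = r powi m"
        using r0 by (simp_all add: algebra_simps flip: power_int_add)
      then show "H (- 1 - m) * (r powi (- 1 - m) + r powi (3 * (- 1 - m) + 1)) = - (H m * (r powi m + r powi (3 * m + 1)))"
        unfolding H_reflect by (simp add: distrib_left mult.assoc)
    qed
    ultimately show ?thesis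
      by (simp add: has_sum_iff algebra_simps)
  qed
  have S_Suc: "S (Suc n) = M 0"
    by (simp add: S_def M_def F_def)
  have "M 1 = M 0" "M 3 = M (- 2)" "M (- 1) = M 2"
    using M_sym[of 1] M_sym[of 3] M_sym[of "- 1"] by simp_all
  with zero1 zero2 have m2: "M 2 = Q\<^sup>2 * M 0" "r * M (- 2) = (Q ^ 4 + r * Q\<^sup>2 - 1) * M 0"
    by (simp_all add: algebra_simps power2_eq_square power4_eq_xxxx)
  have "r * S n = (r + Q\<^sup>2) * (1 - Q ^ 4) * M 0"
    using m2 unfolding S_M by algebra
  moreover have "r + Q\<^sup>2 = r * (1 + r * q ^ n)"
  proof -
    have "Q\<^sup>2 = q * q ^ n" by (simp flip: qn)
    also have "q * q ^ n = r * (r * q ^ n)"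
      using r2 by (simp add: power2_eq_square flip: mult.assoc)
    finally have "Q\<^sup>2 = r * (r * q ^ n)" .
    then show ?thesis by (simp add: algebra_simps)
  qed
  moreover have "Q ^ 4 = q ^ (2 * Suc n)"
  proof -
    have "Q ^ 4 = (Q\<^sup>2)\<^sup>2" by simp
    also have "\<dots> = q ^ (Suc n * 2)" by (simp only: qn[symmetric] power_mult)
    finally show ?thesis by (simp only: mult.commute)
  qed
  ultimately have "r * S n = r * ((1 + r * q ^ n) * (1 - q ^ (2 * Suc n)) * S (Suc n))"
    by (simp add: S_Suc mult_ac)
  then show ?thesis using r0 by simp
qed

lemma pentagonal_bailey_pair:
  "bailey_pair q 0 (pentagonal_coeff r) (pentagonal_beta q r)"
  unfolding bailey_pair_def pentagonal_beta_def
proof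
  fix n
  define S where "S n = (\<Sum>\<^sub>\<infinity>m. pentagonal_coeff r m * (inv_qfact q (int n - m) * inv_qfact q (int n + m)))" for n
  have "S n = 1 / (qpochhammer (q\<^sup>2) (q\<^sup>2) n * qpochhammer (- r) q n)"
  proof (induction n)
    case 0
    have "S 0 = infsum (\<lambda>m. pentagonal_coeff r m * (inv_qfact q (int 0 - m) * inv_qfact q (int 0 + m))) {0}"
      unfolding S_def by (rule infsum_cong_neutral) (auto simp: inv_qfact_def)
    then show ?case
      by (simp add: qpochhammer_0 inv_qfact_0[OF q1] pentagonal_coeff_def)
  next
    case (Suc n)
    have "norm r < 1"
      using q1 abs_square_less_1[of "norm r"] by (simp add: r2[symmetric] norm_power)
    then have "- r * q ^ n \<noteq> 1"
      by (intro neg_mult_power_neq_1 q1)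
    then have "1 + r * q ^ n \<noteq> 0" by (metis add.commute eq_neg_iff_add_eq_0 minus_mult_left)
    moreover have "1 - q ^ (2 * Suc n) \<noteq> 0"
      by (rule one_minus_power_nonzero[OF q1]) simp
    ultimately have "S (Suc n) = S n / ((1 + r * q ^ n) * (1 - q ^ (2 * Suc n)))"
      using pentagonal_sum_rec[of n] by (simp add: S_def)
    moreover have "1 - q\<^sup>2 * (q\<^sup>2) ^ n = 1 - q ^ (2 * Suc n)"
      by (simp add: power_mult power2_eq_square power_mult_distrib)
    ultimately show ?case
      by (simp add: Suc.IH qpochhammer_Suc del: mult_Suc_right)
  qed
  moreover have "(\<lambda>m. pentagonal_coeff r m * (inv_qfact q (int n - m) * inv_qfact q (int n + m))) summable_on UNIV"
    by (rule bounded_int_support_summable[of "int n"]) (use bailey_kernel_eq_0[of n 0] in simp)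
  ultimately show "((\<lambda>m. pentagonal_coeff r m * (inv_qfact q (int n - m) * inv_qfact q (int n + m + int 0))) has_sum
      1 / (qpochhammer (q\<^sup>2) (q\<^sup>2) n * qpochhammer (- r) q n)) UNIV"
    by (simp add: S_def has_sum_iff)
qed

end

section \<open>Euler's q-exponential series and the Jacobi triple product\<close>

text \<open>
  The summands of the series in the Jacobi triple product identity with base \<open>q\<close> and argument \<open>z\<close>.
\<close>
definition theta_coeff :: "complex \<Rightarrow> complex \<Rightarrow> int \<Rightarrow> complex" where
  "theta_coeff q z m = (- z) powi m * q powi (m * (m - 1) div 2)"

context
  fixes q :: complex
  assumes q1: "norm q < 1"
begin

text \<open>
  The q-binomial theorem divided by \<open>(q; q)\<^sub>N\<close>. By the Pascal rule
  for \<open>1 / ((q; q)\<^sub>m (q; q)\<^bsub>N - m\<^esub>)\<close>, passing from \<open>N\<close> to \<open>N + 1\<close> multiplies the sum by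
  \<open>(1 + a q\<^sup>N) / (1 - q\<^bsup>N + 1\<^esup>)\<close>.
\<close>
lemma finite_q_binomial:
  "(\<Sum>m\<le>N. q ^ (m choose 2) * a ^ m * (inv_qfact q (int m) * inv_qfact q (int N - int m)))
    = qpochhammer (- a) q N * inv_qfact q (int N)"
proof (induction N)
  case 0
  show ?case by (simp add: inv_qfact_0[OF q1] qpochhammer_0 numeral_2_eq_2)
next
  case (Suc N)
  define u where "u = inv_qfact q"
  define c where "c m = q ^ (m choose 2) * a ^ m" for m
  have c_Suc: "c (Suc m) = a * q ^ m * c m" for m
    by (simp add: c_def numeral_2_eq_2 power_add mult_ac)
  have split: "(1 - q ^ Suc N) * (c m * (u (int m) * u (int (Suc N) - int m)))
      = c m * (u (int m) * u (int N - int m)) + q ^ (Suc N - m) * c m * (u (int m - 1) * u (int (Suc N) - int m))"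
    if "m \<le> Suc N" for m
  proof -
    have "u (int N - int m) = (1 - q ^ (Suc N - m)) * u (int (Suc N) - int m)"
    proof -
      have "int (Suc N) - int m = int (Suc N - m)" "int N - int m = int (Suc N - m) - 1"
        using that by auto
      then show ?thesis
        using inv_qfact_pred[OF q1, of "int (Suc N - m)"] by (simp only: u_def power_int_of_nat)
    qed
    moreover have "u (int m - 1) = (1 - q ^ m) * u (int m)"
      using inv_qfact_pred[OF q1, of "int m"] by (simp add: u_def power_int_of_nat)
    moreover have "q ^ Suc N = q ^ m * q ^ (Suc N - m)"
      using that by (simp flip: power_add)
    ultimately show ?thesis
      by (simp only:) (simp only: algebra_simps mult_1_left)
  qed
  have "(1 - q ^ Suc N) * (\<Sum>m\<le>Suc N. c m * (u (int m) * u (int (Suc N) - int m)))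
     = (\<Sum>m\<le>Suc N. c m * (u (int m) * u (int N - int m)))
       + (\<Sum>m\<le>Suc N. q ^ (Suc N - m) * c m * (u (int m - 1) * u (int (Suc N) - int m)))"
    unfolding sum_distrib_left sum.distrib[symmetric] by (intro sum.cong refl split) simp
  also have "(\<Sum>m\<le>Suc N. c m * (u (int m) * u (int N - int m))) = (\<Sum>m\<le>N. c m * (u (int m) * u (int N - int m)))"
    by (simp add: u_def inv_qfact_neg)
  also have "(\<Sum>m\<le>Suc N. q ^ (Suc N - m) * c m * (u (int m - 1) * u (int (Suc N) - int m)))
     = (\<Sum>m\<le>N. q ^ (N - m) * c (Suc m) * (u (int m) * u (int N - int m)))"
    by (subst sum.atMost_Suc_shift) (simp add: u_def inv_qfact_neg)
  also have "\<dots> = (\<Sum>m\<le>N. a * q ^ N * (c m * (u (int m) * u (int N - int m))))"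
  proof (intro sum.cong refl)
    fix m assume "m \<in> {..N}"
    then have "q ^ N = q ^ (N - m) * q ^ m" by (simp flip: power_add)
    then show "q ^ (N - m) * c (Suc m) * (u (int m) * u (int N - int m)) = a * q ^ N * (c m * (u (int m) * u (int N - int m)))"
      by (simp add: c_Suc)
  qed
  finally have "(1 - q ^ Suc N) * (\<Sum>m\<le>Suc N. c m * (u (int m) * u (int (Suc N) - int m)))
    = (1 + a * q ^ N) * (\<Sum>m\<le>N. c m * (u (int m) * u (int N - int m)))"
    by (simp add: sum_distrib_left[symmetric] distrib_right del: sum.atMost_Suc)
  also have "\<dots> = qpochhammer (- a) q (Suc N) * u (int N)"
    using Suc.IH by (simp add: c_def u_def qpochhammer_Suc)
  also have "u (int N) = (1 - q ^ Suc N) * u (int (Suc N))"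
    using inv_qfact_pred[OF q1, of "int (Suc N)"] by (simp add: u_def power_int_of_nat del: power_Suc of_nat_Suc) simp
  finally show ?case
    using one_minus_power_nonzero[OF q1, of "Suc N"] by (simp add: u_def c_def)
qed

text \<open>
  The limit \<open>N \<rightarrow> \<infinity>\<close> of \<open>finite_q_binomial\<close>.
\<close>
theorem euler_q_exponential:
  "((\<lambda>m. q ^ (m choose 2) * a ^ m / qpochhammer q q m) has_sum qpochhammer_inf (- a) q) UNIV"
proof -
  obtain C where C: "C \<ge> 1" "\<And>j. norm (inv_qfact q j) \<le> C"
    using inv_qfact_bounded[OF q1] by blast
  define l where "l = 1 / qpochhammer_inf q q"
  have "((\<lambda>m. q ^ (m choose 2) * a ^ m * (inv_qfact q (int m) * l)) has_sum (qpochhammer_inf (- a) q * l)) UNIV"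
  proof (rule dominated_convergence_infsum_has_sum)
    show "(\<lambda>m. C * C * (norm a ^ m * norm q ^ (m choose 2))) summable_on UNIV"
      by (intro summable_on_cmult_right summable_power_choose_two) (auto simp: q1)
    fix N m
    have "norm (inv_qfact q (int m)) * norm (inv_qfact q (int N - int m)) \<le> C * C"
      using C by (intro mult_mono) auto
    then have "norm (inv_qfact q (int m)) * norm (inv_qfact q (int N - int m)) * (norm a ^ m * norm q ^ (m choose 2))
        \<le> C * C * (norm a ^ m * norm q ^ (m choose 2))"
      by (rule mult_right_mono) simp
    then show "norm (q ^ (m choose 2) * a ^ m * (inv_qfact q (int m) * inv_qfact q (int N - int m))) \<le> C * C * (norm a ^ m * norm q ^ (m choose 2))"
      by (simp add: norm_mult norm_power mult_ac)
  next
    fix m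
    have "(\<lambda>N. inv_qfact q (int N - int m)) \<longlonglongrightarrow> l"
      using inv_qfact_tendsto[OF q1, of "- int m"] by (simp add: l_def)
    then show "(\<lambda>N. q ^ (m choose 2) * a ^ m * (inv_qfact q (int m) * inv_qfact q (int N - int m))) \<longlonglongrightarrow>
        q ^ (m choose 2) * a ^ m * (inv_qfact q (int m) * l)"
      by (intro tendsto_intros)
  next
    fix N
    have "((\<lambda>m. q ^ (m choose 2) * a ^ m * (inv_qfact q (int m) * inv_qfact q (int N - int m))) has_sum
       (\<Sum>m\<le>N. q ^ (m choose 2) * a ^ m * (inv_qfact q (int m) * inv_qfact q (int N - int m)))) UNIV"
      by (rule has_sum_finite_neutralI) (auto simp: inv_qfact_neg)
    then show "((\<lambda>m. q ^ (m choose 2) * a ^ m * (inv_qfact q (int m) * inv_qfact q (int N - int m))) has_sum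
       (qpochhammer (- a) q N * inv_qfact q (int N))) UNIV"
      by (simp only: finite_q_binomial)
  next
    have "(\<lambda>N. inv_qfact q (int N)) \<longlonglongrightarrow> l"
      using inv_qfact_tendsto[OF q1, of 0] by (simp add: l_def)
    then show "(\<lambda>N. qpochhammer (- a) q N * inv_qfact q (int N)) \<longlonglongrightarrow> qpochhammer_inf (- a) q * l"
      by (intro tendsto_mult qpochhammer_tendsto q1)
  qed
  from has_sum_cmult_right[OF this, where c = "qpochhammer_inf q q"]
  show ?thesis
    using qfact_inf_nonzero[OF q1] by (simp add: l_def inv_qfact_of_nat)
qed

text \<open>
  For fixed \<open>m\<close> the kernel tends to \<open>1 / (q; q)\<^sub>\<infinity>\<^sup>2\<close>, and it is bounded in \<open>n\<close> and \<open>m\<close> together.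
\<close>
lemma tendsto_bailey_sum:
  fixes g :: "int \<Rightarrow> complex"
  assumes g: "g summable_on UNIV"
    and S: "bailey_pair q 0 g S" and L: "S \<longlonglongrightarrow> L"
  shows "(g has_sum (L * (qpochhammer_inf q q)\<^sup>2)) UNIV"
proof -
  obtain C where C: "C \<ge> 1" "\<And>j. norm (inv_qfact q j) \<le> C"
    using inv_qfact_bounded[OF q1] by blast
  define l where "l = 1 / qpochhammer_inf q q"
  have "((\<lambda>m. g m * (l * l)) has_sum L) UNIV"
  proof (rule dominated_convergence_infsum_has_sum)
    show "(\<lambda>m. norm (g m) * (C * C)) summable_on UNIV"
      using g by (intro summable_on_cmult_left) (simp flip: summable_on_iff_abs_summable_on_complex)
    fix N :: nat and m
    have "norm (inv_qfact q (int N - m)) * norm (inv_qfact q (int N + m)) \<le> C * C"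
      using C by (intro mult_mono) auto
    then show "norm (g m * (inv_qfact q (int N - m) * inv_qfact q (int N + m))) \<le> norm (g m) * (C * C)"
      by (simp add: norm_mult mult_left_mono)
  next
    fix m
    show "(\<lambda>N. g m * (inv_qfact q (int N - m) * inv_qfact q (int N + m))) \<longlonglongrightarrow> g m * (l * l)"
      using inv_qfact_tendsto[OF q1, of "- m"] inv_qfact_tendsto[OF q1, of m]
      by (intro tendsto_intros) (simp_all add: l_def)
  next
    show "((\<lambda>m. g m * (inv_qfact q (int N - m) * inv_qfact q (int N + m))) has_sum S N) UNIV" for N
      using S by (simp add: bailey_pair_def)
  qed (rule L)
  from has_sum_cmult_left[OF this, where c = "(qpochhammer_inf q q)\<^sup>2"]
  show ?thesis
    using qfact_inf_nonzero[OF q1] by (simp add: l_def power2_eq_square)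
qed

context
  fixes z :: complex
  assumes q0: "q \<noteq> 0" and z0: "z \<noteq> 0"
begin

lemma theta_coeff_Suc: "theta_coeff q z (m + 1) = - z * q powi m * theta_coeff q z m"
proof -
  have "(m + 1) * (m + 1 - 1) = m * (m - 1) + m * 2" by (simp add: algebra_simps)
  then have "(m + 1) * (m + 1 - 1) div 2 = m * (m - 1) div 2 + m"
    by (metis div_mult_self1 add.commute zero_neq_numeral)
  then show ?thesis
    using q0 z0 by (simp add: theta_coeff_def power_int_add)
qed

text \<open>
  This reduces the coefficients with negative index to those with nonnegative index.
\<close>
lemma theta_coeff_uminus: "theta_coeff q z (- m) = theta_coeff q (q / z) m"
proof -
  have "- m * (- m - 1) = m * (m - 1) + m * 2" by (simp add: algebra_simps)
  then have "- m * (- m - 1) div 2 = m * (m - 1) div 2 + m"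
    by (metis div_mult_self1 add.commute zero_neq_numeral)
  moreover have "(- z) powi (- m) * q powi m = (- (q / z)) powi m"
    by (simp add: power_int_minus power_int_divide_distrib flip: divide_minus_right) (simp add: field_simps)
  ultimately show ?thesis
    using q0 by (simp add: theta_coeff_def power_int_add)
qed

end

lemma theta_coeff_of_nat: "theta_coeff q z (int n) = (- z) ^ n * q ^ (n choose 2)"
proof -
  have "int n * (int n - 1) div 2 = int (n choose 2)"
    by (cases n) (simp_all add: choose_two zdiv_int algebra_simps)
  then show ?thesis
    by (simp add: theta_coeff_def power_int_of_nat)
qed

context
  fixes z :: complex
  assumes q0: "q \<noteq> 0" and z0: "z \<noteq> 0"
begin

lemma theta_coeff_summable: "theta_coeff q z summable_on UNIV"
proof -
  have "(\<lambda>m. norm (theta_coeff q z m)) summable_on UNIV"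
    by (rule summable_on_int_split)
      (simp_all add: theta_coeff_uminus[OF q0 z0] theta_coeff_of_nat norm_mult norm_power q1 summable_power_choose_two)
  then show ?thesis by (rule abs_summable_summable)
qed

text \<open>
  MacMahon's finite form of the triple product, by induction on \<open>N\<close>. Multiplication by the two new
  factors \<open>(1 - z q\<^sup>N) (1 - q\<^bsup>N + 1\<^esup> / z)\<close> combines three neighbouring coefficients, and the
  resulting identity between the summands (\<open>step\<close>) is polynomial in \<open>q\<close>, \<open>q\<^bsup>N - m\<^esup>\<close> and \<open>q\<^bsup>N + m\<^esup>\<close>.
\<close>
lemma finite_jacobi_triple_product:
  "bailey_pair q 0 (theta_coeff q z) (\<lambda>N. qpochhammer z q N * qpochhammer (q / z) q N * inv_qfact q (int (2 * N)))"
proof -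
  define u where "u = inv_qfact q"
  define T where "T N m = theta_coeff q z m * (u (int N - m) * u (int N + m))" for N m
  have step: "(1 - q ^ (2 * N + 2)) * (1 - q ^ (2 * N + 1)) * T (Suc N) m
     = (1 + q ^ (2 * N + 1)) * T N m + (- (z * q ^ N) * T N (m - 1) + - (q ^ Suc N / z) * T N (m + 1))" for N m
  proof -
    \<comment> \<open>The summands at \<open>m\<close> and its neighbours differ from the one for \<open>N + 1\<close> by factors that are
      polynomial in \<open>q\<close>, \<open>a\<close> and \<open>b\<close>, apart from powers that the theta coefficients absorb.\<close>
    define a b where "a = q powi (int N - m)" and "b = q powi (int N + m)"
    have qa: "q powi (int N - m + 1) = q * a" and qb: "q powi (int N + m + 1) = q * b"
      using q0 by (simp_all add: a_def b_def power_int_add mult_ac)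
    have ab: "a * b = q ^ (2 * N)"
      using q0 by (simp add: a_def b_def flip: power_int_add power_int_of_nat)
    define X Y where "X = u (int N - m + 1)" and "Y = u (int N + m + 1)"
    have ua: "u (int N - m) = (1 - q * a) * X"
      using inv_qfact_pred[OF q1, of "int N - m + 1", unfolded qa] by (simp add: X_def u_def)
    have ub: "u (int N + m) = (1 - q * b) * Y"
      using inv_qfact_pred[OF q1, of "int N + m + 1", unfolded qb] by (simp add: Y_def u_def)
    have ua': "u (int N - (m + 1)) = (1 - a) * ((1 - q * a) * X)"
    proof -
      have "int N - (m + 1) = int N - m - 1" by simp
      then show ?thesis
        using inv_qfact_pred[OF q1, of "int N - m"] by (simp only: u_def[symmetric] a_def[symmetric] ua)
    qed
    have ub': "u (int N + (m - 1)) = (1 - b) * ((1 - q * b) * Y)"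
    proof -
      have "int N + (m - 1) = int N + m - 1" by simp
      then show ?thesis
        using inv_qfact_pred[OF q1, of "int N + m"] by (simp only: u_def[symmetric] b_def[symmetric] ub)
    qed
    have t1: "z * q ^ N * theta_coeff q z (m - 1) = - (q * a) * theta_coeff q z m"
    proof -
      have "theta_coeff q z m = - z * q powi (m - 1) * theta_coeff q z (m - 1)"
        using theta_coeff_Suc[OF q0 z0, of "m - 1"] by simp
      moreover have "q * a * q powi (m - 1) = q ^ N"
        using q0 unfolding qa[symmetric] by (simp flip: power_int_add)
      ultimately show ?thesis by (simp add: algebra_simps)
    qed
    have t2: "q ^ Suc N / z * theta_coeff q z (m + 1) = - (q * b) * theta_coeff q z m"
    proof -
      have "q powi m * q ^ Suc N = q * b"
      proof -
        have "q * b = q powi (m + int (Suc N))"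
          unfolding qb[symmetric] by (simp add: algebra_simps)
        also have "\<dots> = q powi m * q powi int (Suc N)"
          using q0 by (intro power_int_add) auto
        finally show ?thesis by (simp only: power_int_of_nat)
      qed
      then show ?thesis
        using z0 q0 by (auto simp: theta_coeff_Suc[OF q0 z0] mult_ac)
    qed
    have X': "u (int N - (m - 1)) = X" and Y': "u (int N + (m + 1)) = Y"
      by (simp_all add: X_def Y_def algebra_simps)
    have "(1 + q ^ (2 * N + 1)) * T N m + (- (z * q ^ N) * T N (m - 1) + - (q ^ Suc N / z) * T N (m + 1))
      = (1 + q * (a * b)) * T N m + (- (z * q ^ N * theta_coeff q z (m - 1)) * (u (int N - (m - 1)) * u (int N + (m - 1)))
         + - (q ^ Suc N / z * theta_coeff q z (m + 1)) * (u (int N - (m + 1)) * u (int N + (m + 1))))"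
      unfolding T_def ab by simp
    also have "\<dots> = theta_coeff q z m * (X * Y) * ((1 + q * (a * b)) * ((1 - q * a) * (1 - q * b))
        + q * a * ((1 - b) * (1 - q * b)) + q * b * ((1 - a) * (1 - q * a)))"
      unfolding t1 t2 T_def ua ub ua' ub' X' Y' by (simp add: algebra_simps)
    also have "(1 + q * (a * b)) * ((1 - q * a) * (1 - q * b))
        + q * a * ((1 - b) * (1 - q * b)) + q * b * ((1 - a) * (1 - q * a))
       = (1 - q * q * (a * b)) * (1 - q * (a * b))"
      by (simp add: algebra_simps)
    also have "theta_coeff q z m * (X * Y) = T (Suc N) m"
    proof -
      have "int N - m + 1 = int (Suc N) - m" "int N + m + 1 = int (Suc N) + m" by simp_all
      then show ?thesis by (simp only: T_def X_def Y_def)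
    qed
    finally show ?thesis
      unfolding ab by (simp add: mult_ac)
  qed
  have "(T N has_sum (qpochhammer z q N * qpochhammer (q / z) q N * u (int (2 * N)))) UNIV" for N
  proof (induction N)
    case 0
    have "(T 0 has_sum T 0 0) UNIV"
      by (rule has_sum_finite_neutralI[of "{0}"]) (auto simp: T_def u_def inv_qfact_def)
    moreover have "T 0 0 = qpochhammer z q 0 * qpochhammer (q / z) q 0 * u (int (2 * 0))"
      by (simp add: T_def u_def inv_qfact_0[OF q1] qpochhammer_0 theta_coeff_def)
    ultimately show ?case by (simp only:)
  next
    case (Suc N)
    let ?A = "qpochhammer z q N * qpochhammer (q / z) q N * u (int (2 * N))"
    have "((\<lambda>m. T N (m - 1)) has_sum ?A) UNIV" "((\<lambda>m. T N (m + 1)) has_sum ?A) UNIV"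
      using Suc.IH has_sum_int_shift[of "T N" "- 1" ?A] has_sum_int_shift[of "T N" 1 ?A] by simp_all
    with Suc.IH have "((\<lambda>m. (1 - q ^ (2 * N + 2)) * (1 - q ^ (2 * N + 1)) * T (Suc N) m) has_sum
       ((1 + q ^ (2 * N + 1)) * ?A + (- (z * q ^ N) * ?A + - (q ^ Suc N / z) * ?A))) UNIV"
      unfolding step by (intro has_sum_add has_sum_cmult_right)
    also have "(1 + q ^ (2 * N + 1)) * ?A + (- (z * q ^ N) * ?A + - (q ^ Suc N / z) * ?A)
       = (1 - z * q ^ N) * (1 - q / z * q ^ N) * ?A"
    proof -
      have "(1 - z * q ^ N) * (1 - q / z * q ^ N) = 1 + q ^ (2 * N + 1) - z * q ^ N - q ^ Suc N / z"
        using z0 power_add[of q N N] by (simp add: field_simps mult_2_right)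
      moreover have "x * A + (- y * A + - w * A) = (x - y - w) * A" for x y w A :: complex
        by (simp add: algebra_simps)
      ultimately show ?thesis by (simp only:)
    qed
    also have "\<dots> = (1 - q ^ (2 * N + 2)) * (1 - q ^ (2 * N + 1)) *
        (qpochhammer z q (Suc N) * qpochhammer (q / z) q (Suc N) * u (int (2 * Suc N)))"
    proof -
      have "u (int (2 * N)) = (1 - q ^ (2 * N + 1)) * u (int (2 * N + 1))"
        using inv_qfact_pred[OF q1, of "int (2 * N + 1)"] unfolding power_int_of_nat by (simp add: u_def)
      also have "u (int (2 * N + 1)) = (1 - q ^ (2 * N + 2)) * u (int (2 * N + 2))"
        using inv_qfact_pred[OF q1, of "int (2 * N + 2)"] unfolding power_int_of_nat by (simp add: u_def)
      finally show ?thesis by (simp add: qpochhammer_Suc mult_ac)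
    qed
    finally show ?case
      using one_minus_power_nonzero[OF q1, of "2 * N + 2"] one_minus_power_nonzero[OF q1, of "2 * N + 1"]
      by (subst (asm) has_sum_cmult_right_iff) (auto simp: mult.assoc)
  qed
  then show ?thesis
    unfolding bailey_pair_def T_def u_def by simp
qed

theorem jacobi_triple_product:
  "(theta_coeff q z has_sum
     (qpochhammer_inf z q * qpochhammer_inf (q / z) q * qpochhammer_inf q q)) UNIV"
proof -
  have "(\<lambda>N. inv_qfact q (int N)) \<longlonglongrightarrow> 1 / qpochhammer_inf q q"
    using inv_qfact_tendsto[OF q1, of 0] by simp
  then have "(\<lambda>N. inv_qfact q (int (2 * N))) \<longlonglongrightarrow> 1 / qpochhammer_inf q q"
    by (rule LIMSEQ_subseq_LIMSEQ[where f = "\<lambda>N. 2 * N", unfolded o_def]) (simp add: strict_mono_def)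
  then have "(\<lambda>N. qpochhammer z q N * qpochhammer (q / z) q N * inv_qfact q (int (2 * N)))
     \<longlonglongrightarrow> qpochhammer_inf z q * qpochhammer_inf (q / z) q * (1 / qpochhammer_inf q q)"
    by (intro tendsto_mult qpochhammer_tendsto q1)
  from tendsto_bailey_sum[OF theta_coeff_summable finite_jacobi_triple_product this]
  show ?thesis
    using qfact_inf_nonzero[OF q1] by (simp add: power2_eq_square mult.assoc)
qed

end

end

section \<open>Nested sums as iterated Bailey steps\<close>

text \<open>
  The tails \<open>(n\<^sub>j, \<dots>, n\<^sub>k)\<close> with \<open>N\<^sub>j = s\<close>.
\<close>
definition level_set :: "nat \<Rightarrow> nat \<Rightarrow> nat \<Rightarrow> (nat \<Rightarrow> nat) set" where
  "level_set k j s = {n \<in> {j..k} \<rightarrow>\<^sub>E UNIV. tail_sum k n j = s}"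

lemma le_tail_sum: "j \<le> l \<Longrightarrow> l \<le> k \<Longrightarrow> n l \<le> tail_sum k n j"
  unfolding tail_sum_def by (rule member_le_sum) auto

lemma tail_sum_rec: "j \<le> k \<Longrightarrow> tail_sum k n j = n j + tail_sum k n (Suc j)"
  unfolding tail_sum_def by (rule sum.atLeast_Suc_atMost)

lemma tail_sum_last: "tail_sum k n k = n k"
  by (simp add: tail_sum_def)

lemma tail_sum_cong: "(\<And>l. j \<le> l \<Longrightarrow> l \<le> k \<Longrightarrow> n l = n' l) \<Longrightarrow> tail_sum k n j = tail_sum k n' j"
  unfolding tail_sum_def by (rule sum.cong) auto

lemma finite_level_set: "finite (level_set k j s)"
proof (rule finite_subset)
  show "level_set k j s \<subseteq> {j..k} \<rightarrow>\<^sub>E {..s}"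
    by (auto simp: level_set_def PiE_iff extensional_def intro: le_tail_sum)
  show "finite ({j..k} \<rightarrow>\<^sub>E {..s})"
    by (intro finite_PiE) auto
qed

text \<open>
  The part of the summand that belongs to the levels from \<open>j\<close> on, for a general innermost sequence
  \<open>\<beta>\<close> and general weights \<open>w\<close>. The weight of level \<open>j\<close> itself is left out: it is applied, together
  with \<open>1 / (q; q)\<^bsub>N - s\<^esub>\<close>, when passing to level \<open>j - 1\<close>.
\<close>
definition chain_term ::
  "complex \<Rightarrow> nat \<Rightarrow> (nat \<Rightarrow> nat \<Rightarrow> nat) \<Rightarrow> (nat \<Rightarrow> complex) \<Rightarrow> nat \<Rightarrow> (nat \<Rightarrow> nat) \<Rightarrow> complex" where
  "chain_term q k w \<beta> j n =
     \<beta> (n k) * (\<Prod>l=j..<k. inv_qfact q (int (n l))) * q ^ (\<Sum>l=Suc j..k. w l (tail_sum k n l))"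

definition chain_sum ::
  "complex \<Rightarrow> nat \<Rightarrow> (nat \<Rightarrow> nat \<Rightarrow> nat) \<Rightarrow> (nat \<Rightarrow> complex) \<Rightarrow> nat \<Rightarrow> nat \<Rightarrow> complex" where
  "chain_sum q k w \<beta> j s = (\<Sum>n\<in>level_set k j s. chain_term q k w \<beta> j n)"

lemma chain_term_cong:
  assumes "j \<le> k" and "\<And>l. j \<le> l \<Longrightarrow> l \<le> k \<Longrightarrow> n l = n' l"
  shows "chain_term q k w \<beta> j n = chain_term q k w \<beta> j n'"
proof -
  have "(\<Sum>l=Suc j..k. w l (tail_sum k n l)) = (\<Sum>l=Suc j..k. w l (tail_sum k n' l))"
    using assms by (intro sum.cong refl arg_cong[where f = "w _"] tail_sum_cong) auto
  then show ?thesis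
    using assms unfolding chain_term_def by simp
qed

lemma chain_term_rec:
  assumes "j < k"
  shows "chain_term q k w \<beta> j n
    = q ^ w (Suc j) (tail_sum k n (Suc j)) * inv_qfact q (int (n j)) * chain_term q k w \<beta> (Suc j) n"
proof -
  have "(\<Sum>l=Suc j..k. w l (tail_sum k n l))
      = w (Suc j) (tail_sum k n (Suc j)) + (\<Sum>l=Suc (Suc j)..k. w l (tail_sum k n l))"
    using assms by (intro sum.atLeast_Suc_atMost) auto
  moreover have "(\<Prod>l=j..<k. inv_qfact q (int (n l)))
      = inv_qfact q (int (n j)) * (\<Prod>l=Suc j..<k. inv_qfact q (int (n l)))"
    using assms by (rule prod.atLeast_Suc_lessThan)
  ultimately show ?thesis
    by (simp add: chain_term_def power_add mult_ac)
qed

lemma chain_sum_last: "chain_sum q k w \<beta> k = \<beta>"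
proof
  fix s
  have "level_set k k s = {\<lambda>x\<in>{k}. s}"
    by (auto simp: level_set_def tail_sum_last PiE_iff extensional_def)
  then show "chain_sum q k w \<beta> k s = \<beta> s"
    by (simp add: chain_sum_def chain_term_def)
qed

text \<open>
  A tail starting at \<open>j\<close> with \<open>N\<^sub>j = N\<close> is a tail starting at \<open>j + 1\<close> with some
  \<open>N\<^bsub>j + 1\<^esub> = t \<le> N\<close>, preceded by \<open>n\<^sub>j = N - t\<close>.
\<close>
lemma chain_sum_rec:
  assumes "j < k"
  shows "chain_sum q k w \<beta> j N
    = (\<Sum>t\<le>N. q ^ w (Suc j) t * inv_qfact q (int N - int t) * chain_sum q k w \<beta> (Suc j) t)"
proof -
  have "(\<Sum>t\<le>N. q ^ w (Suc j) t * inv_qfact q (int N - int t) * chain_sum q k w \<beta> (Suc j) t)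
     = (\<Sum>(t, n)\<in>Sigma {..N} (level_set k (Suc j)).
          q ^ w (Suc j) t * inv_qfact q (int N - int t) * chain_term q k w \<beta> (Suc j) n)"
    unfolding chain_sum_def sum_distrib_left by (rule sum.Sigma) (auto simp: finite_level_set)
  also have "\<dots> = (\<Sum>n\<in>level_set k j N. chain_term q k w \<beta> j n)"
  proof (rule sum.reindex_bij_witness[of _ "\<lambda>n. (tail_sum k n (Suc j), n(j := undefined))" "\<lambda>(t, n). n(j := N - t)"])
    fix p assume "p \<in> Sigma {..N} (level_set k (Suc j))"
    then obtain t n where p: "p = (t, n)" "t \<le> N" "n \<in> {Suc j..k} \<rightarrow>\<^sub>E UNIV" "tail_sum k n (Suc j) = t"
      by (auto simp: level_set_def)
    have ts: "tail_sum k (n(j := N - t)) (Suc j) = t"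
      using p(4) by (metis tail_sum_cong fun_upd_other not_less_eq_eq order_refl)
    have nj: "n j = undefined" using p(3) by (auto simp: PiE_iff extensional_def)
    show "(tail_sum k (case p of (t, n) \<Rightarrow> n(j := N - t)) (Suc j),
           (case p of (t, n) \<Rightarrow> n(j := N - t))(j := undefined)) = p"
      using ts nj by (simp add: p(1) fun_upd_idem)
    show "(case p of (t, n) \<Rightarrow> n(j := N - t)) \<in> level_set k j N"
      using ts p(2,3) assms by (auto simp: p(1) level_set_def tail_sum_rec PiE_iff extensional_def)
    have "chain_term q k w \<beta> (Suc j) (n(j := N - t)) = chain_term q k w \<beta> (Suc j) n"
      using assms by (intro chain_term_cong) auto
    then show "chain_term q k w \<beta> j (case p of (t, n) \<Rightarrow> n(j := N - t)) =
        (case p of (t, n) \<Rightarrow> q ^ w (Suc j) t * inv_qfact q (int N - int t) * chain_term q k w \<beta> (Suc j) n)"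
      using ts p(2) by (simp add: p(1) chain_term_rec[OF assms] of_nat_diff)
  next
    fix n assume "n \<in> level_set k j N"
    then have n: "n \<in> {j..k} \<rightarrow>\<^sub>E UNIV" "n j + tail_sum k n (Suc j) = N"
      using assms by (auto simp: level_set_def tail_sum_rec)
    have ts: "tail_sum k (n(j := undefined)) (Suc j) = tail_sum k n (Suc j)"
      by (intro tail_sum_cong) auto
    have "N - tail_sum k n (Suc j) = n j" using n(2) by simp
    then show "(case (tail_sum k n (Suc j), n(j := undefined)) of (t, n) \<Rightarrow> n(j := N - t)) = n"
      by simp
    show "(tail_sum k n (Suc j), n(j := undefined)) \<in> Sigma {..N} (level_set k (Suc j))"
      using n ts by (auto simp: level_set_def PiE_iff extensional_def)
  qed
  finally show ?thesis by (simp add: chain_sum_def)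
qed

definition level_weight :: "nat \<Rightarrow> nat \<Rightarrow> nat \<Rightarrow> nat" where
  "level_weight i l N = N\<^sup>2 + (if i \<le> l then N else 0)"

context
  fixes q r :: complex and k i :: nat
  assumes q1: "norm q < 1" and r2: "r\<^sup>2 = q" and r0: "r \<noteq> 0" and ik: "1 \<le> i" "i \<le> k + 1"
begin

lemma q_nonzero: "q \<noteq> 0"
  using r2 r0 by auto

text \<open>
  The powers of \<open>q\<^bsup>m\<^sup>2 + m\<^esup>\<close> accumulated with \<open>e = 1\<close> are invariant under \<open>m \<mapsto> -1 - m\<close> and so do not
  disturb the antisymmetry of the pentagonal coefficients.
\<close>
lemma bailey_pair_change_parameter_pentagonal:
  "bailey_pair q 0 (\<lambda>m. q powi (c * (m\<^sup>2 + m)) * pentagonal_coeff r m) B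
   \<longleftrightarrow> bailey_pair q 1 (\<lambda>m. q powi (c * (m\<^sup>2 + m)) * pentagonal_coeff r m) B"
proof (rule bailey_pair_change_parameter[OF q1 q_nonzero])
  fix m :: int
  have "(- 1 - m)\<^sup>2 + (- 1 - m) = m\<^sup>2 + m" by (simp add: power2_eq_square algebra_simps)
  moreover have "r powi (4 * m + 2) = q powi (2 * m + 1)"
    unfolding q_powi_eq[OF q1 r2 r0] by (simp add: algebra_simps)
  ultimately show "q powi (c * ((- 1 - m)\<^sup>2 + (- 1 - m))) * pentagonal_coeff r (- 1 - m)
     = - (q powi (c * (m\<^sup>2 + m)) * pentagonal_coeff r m * q powi (2 * m + 1))"
    by (simp only: pentagonal_coeff_reflect[OF r0]) simp
qed

text \<open>
  While the weights are \<open>N\<^sup>2 + N\<close>, the steps are taken with \<open>e = 1\<close>.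
\<close>
lemma bailey_pair_upper_levels:
  assumes "j \<le> k" "i \<le> j + 1"
  shows "bailey_pair q 1 (\<lambda>m. q powi (int (k - j) * (m\<^sup>2 + m)) * pentagonal_coeff r m)
           (chain_sum q k (level_weight i) (pentagonal_beta q r) j)"
  using assms
proof (induction j rule: inc_induct)
  case base
  have "bailey_pair q 0 (pentagonal_coeff r) (pentagonal_beta q r)"
    by (rule pentagonal_bailey_pair[OF q1 r2 r0])
  then show ?case
    using bailey_pair_change_parameter_pentagonal[of 0 "pentagonal_beta q r"] by (simp add: chain_sum_last)
next
  case (step j)
  have "bailey_pair q 1 (\<lambda>m. q powi (m\<^sup>2 + int 1 * m) * (q powi (int (k - Suc j) * (m\<^sup>2 + m)) * pentagonal_coeff r m))
     (\<lambda>N. \<Sum>s\<le>N. q ^ (s\<^sup>2 + 1 * s) * inv_qfact q (int N - int s) * chain_sum q k (level_weight i) (pentagonal_beta q r) (Suc j) s)"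
    using step by (intro bailey_pair_step[OF q1]) auto
  also have "(\<lambda>N. \<Sum>s\<le>N. q ^ (s\<^sup>2 + 1 * s) * inv_qfact q (int N - int s) * chain_sum q k (level_weight i) (pentagonal_beta q r) (Suc j) s)
     = chain_sum q k (level_weight i) (pentagonal_beta q r) j"
    using step by (simp add: chain_sum_rec level_weight_def fun_eq_iff)
  also have "(\<lambda>m. q powi (m\<^sup>2 + int 1 * m) * (q powi (int (k - Suc j) * (m\<^sup>2 + m)) * pentagonal_coeff r m))
     = (\<lambda>m. q powi (int (k - j) * (m\<^sup>2 + m)) * pentagonal_coeff r m)"
  proof
    fix m
    have "int (k - j) * (m\<^sup>2 + m) = (m\<^sup>2 + int 1 * m) + int (k - Suc j) * (m\<^sup>2 + m)"
      using step.hyps by (simp add: of_nat_diff algebra_simps)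
    then show "q powi (m\<^sup>2 + int 1 * m) * (q powi (int (k - Suc j) * (m\<^sup>2 + m)) * pentagonal_coeff r m)
       = q powi (int (k - j) * (m\<^sup>2 + m)) * pentagonal_coeff r m"
      using q_nonzero by (simp only: power_int_add mult.assoc simp_thms)
  qed
  finally show ?case .
qed

text \<open>
  At level \<open>i - 1\<close> the pair is switched to \<open>e = 0\<close>; the weights of the remaining levels are \<open>N\<^sup>2\<close>.
  The lemma extends to \<open>j = 0\<close>, one level beyond the multiple sum: the sequence there is
  \<open>N \<mapsto> \<Sum>\<^sub>s a\<^sub>s / (q; q)\<^bsub>N - s\<^esub>\<close>, where \<open>\<Sum>\<^sub>s a\<^sub>s\<close> is the sum over \<open>n\<^sub>1, \<dots>, n\<^sub>k\<close> that
  remains once \<open>m\<close> has been summed out.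
\<close>
lemma bailey_pair_lower_levels:
  assumes "j \<le> i - 1"
  shows "bailey_pair q 0 (\<lambda>m. q powi (int (k + 1 - i) * (m\<^sup>2 + m) + int (i - 1 - j) * m\<^sup>2) * pentagonal_coeff r m)
           (chain_sum q k (level_weight i) (pentagonal_beta q r) j)"
  using assms
proof (induction j rule: inc_induct)
  case base
  have "k - (i - 1) = k + 1 - i" using ik by simp
  then show ?case
    using bailey_pair_upper_levels[of "i - 1"] ik bailey_pair_change_parameter_pentagonal by simp
next
  case (step j)
  have "bailey_pair q 0 (\<lambda>m. q powi (m\<^sup>2 + int 0 * m) *
          (q powi (int (k + 1 - i) * (m\<^sup>2 + m) + int (i - 1 - Suc j) * m\<^sup>2) * pentagonal_coeff r m))
     (\<lambda>N. \<Sum>s\<le>N. q ^ (s\<^sup>2 + 0 * s) * inv_qfact q (int N - int s) * chain_sum q k (level_weight i) (pentagonal_beta q r) (Suc j) s)"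
    using step by (intro bailey_pair_step[OF q1]) auto
  also have "(\<lambda>N. \<Sum>s\<le>N. q ^ (s\<^sup>2 + 0 * s) * inv_qfact q (int N - int s) * chain_sum q k (level_weight i) (pentagonal_beta q r) (Suc j) s)
     = chain_sum q k (level_weight i) (pentagonal_beta q r) j"
  proof -
    have "j < k" "\<not> i \<le> Suc j" using step.hyps ik by auto
    then show ?thesis by (simp add: chain_sum_rec level_weight_def fun_eq_iff)
  qed
  also have "(\<lambda>m. q powi (m\<^sup>2 + int 0 * m) *
          (q powi (int (k + 1 - i) * (m\<^sup>2 + m) + int (i - 1 - Suc j) * m\<^sup>2) * pentagonal_coeff r m))
     = (\<lambda>m. q powi (int (k + 1 - i) * (m\<^sup>2 + m) + int (i - 1 - j) * m\<^sup>2) * pentagonal_coeff r m)"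
  proof
    fix m
    have "int (i - 1 - j) = int (i - 1 - Suc j) + 1"
      using step.hyps by auto
    moreover have "c * (m\<^sup>2 + m) + (d + 1) * m\<^sup>2 = (m\<^sup>2 + int 0 * m) + (c * (m\<^sup>2 + m) + d * m\<^sup>2)" for c d
      by (simp add: algebra_simps)
    ultimately have "int (k + 1 - i) * (m\<^sup>2 + m) + int (i - 1 - j) * m\<^sup>2
        = (m\<^sup>2 + int 0 * m) + (int (k + 1 - i) * (m\<^sup>2 + m) + int (i - 1 - Suc j) * m\<^sup>2)"
      by (simp only:)
    then show "q powi (m\<^sup>2 + int 0 * m) * (q powi (int (k + 1 - i) * (m\<^sup>2 + m) + int (i - 1 - Suc j) * m\<^sup>2) * pentagonal_coeff r m)
       = q powi (int (k + 1 - i) * (m\<^sup>2 + m) + int (i - 1 - j) * m\<^sup>2) * pentagonal_coeff r m"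
      using q_nonzero by (simp only: power_int_add[of q "m\<^sup>2 + int 0 * m"] mult.assoc simp_thms)
  qed
  finally show ?case .
qed

text \<open>
  In terms of \<open>t = m (m + 1) / 2\<close>, both sides have the \<open>r\<close>-exponent \<open>(4k + 3) t - 2 i m\<close>.
\<close>
lemma pentagonal_coeff_eq_theta_coeff:
  "q powi (int (k + 1 - i) * (m\<^sup>2 + m) + int (i - 1) * m\<^sup>2) * pentagonal_coeff r m
    = theta_coeff (r ^ (3 + 4 * k)) (q ^ i) (- m)"
proof -
  define t where "t = m * (m + 1) div 2"
  have "even (m * (m + 1))" by simp
  then have "2 * t = m * (m + 1)"
    unfolding t_def by (rule dvd_mult_div_cancel)
  then have t: "m\<^sup>2 + m = 2 * t"
    by (simp add: power2_eq_square distrib_left)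
  then have "3 * m\<^sup>2 - m = 2 * (3 * t - 2 * m)" by simp
  then have "(3 * m\<^sup>2 - m) div 2 = 3 * t - 2 * m" by simp
  moreover have "- m * (- m - 1) div 2 = t"
  proof -
    have "- m * (- m - 1) = m * (m + 1)" by (simp add: algebra_simps)
    then show ?thesis by (simp only: t_def)
  qed
  moreover have "2 * (int (k + 1 - i) * (m\<^sup>2 + m) + int (i - 1) * m\<^sup>2) + (3 * t - 2 * m)
     = 2 * int i * (- m) + int (3 + 4 * k) * t"
  proof -
    have "int (k + 1 - i) = int k + 1 - int i" "int (i - 1) = int i - 1" "m\<^sup>2 = 2 * t - m"
      using ik t by auto
    then show ?thesis by (simp only: t) (simp add: algebra_simps)
  qed
  ultimately have exps: "(3 * m\<^sup>2 - m) div 2 = 3 * t - 2 * m" "- m * (- m - 1) div 2 = t"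
    "2 * (int (k + 1 - i) * (m\<^sup>2 + m) + int (i - 1) * m\<^sup>2) + (3 * t - 2 * m)
     = 2 * int i * (- m) + int (3 + 4 * k) * t"
    by blast+
  have sign: "(- (q ^ i)) powi (- m) = (- 1) powi m * r powi (2 * int i * (- m))"
  proof -
    have "q ^ i = r powi (2 * int i)"
      by (simp add: power_int_mult r2)
    then have "(- (q ^ i)) powi (- m) = (- 1) powi (- m) * (r powi (2 * int i)) powi (- m)"
      by (simp flip: power_int_mult_distrib)
    then show ?thesis
      by (simp only: minus_one_powi_uminus power_int_mult[symmetric])
  qed
  have base: "(r ^ (3 + 4 * k)) powi t = r powi (int (3 + 4 * k) * t)"
    by (simp only: power_int_mult power_int_of_nat)
  have "q powi (int (k + 1 - i) * (m\<^sup>2 + m) + int (i - 1) * m\<^sup>2) * pentagonal_coeff r m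
     = (- 1) powi m * r powi (2 * (int (k + 1 - i) * (m\<^sup>2 + m) + int (i - 1) * m\<^sup>2) + (3 * t - 2 * m))"
    unfolding pentagonal_coeff_def exps(1) q_powi_eq[OF q1 r2 r0]
    using r0 by (simp add: power_int_add)
  also have "\<dots> = (- 1) powi m * (r powi (2 * int i * (- m)) * r powi (int (3 + 4 * k) * t))"
    unfolding exps(3) by (subst power_int_add) (simp_all add: r0)
  also have "\<dots> = theta_coeff (r ^ (3 + 4 * k)) (q ^ i) (- m)"
    unfolding theta_coeff_def exps(2) sign base by (simp only: mult.assoc)
  finally show ?thesis .
qed

section \<open>Evaluation of the multiple sum\<close>

text \<open>
  Since \<open>\<Sum>\<^sub>j N\<^sub>j\<^sup>2 \<ge> \<Sum>\<^sub>j n\<^sub>j\<close> and \<open>m\<^sup>2 \<ge> m\<close>, and since reciprocals of q-factorials are bounded, the summand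
  is dominated by a product of geometric sequences. This justifies every rearrangement below.
\<close>
lemma summand_summable:
  "(\<lambda>(m, n). summand q r k i m n) summable_on (UNIV \<times> ({1..k} \<rightarrow>\<^sub>E (UNIV :: nat set)))"
proof -
  obtain C where C: "C \<ge> 1" "\<And>j. norm (inv_qfact q j) \<le> C"
    using inv_qfact_bounded[OF q1] by blast
  have q2: "norm (q\<^sup>2) < 1"
    using norm_power_lt_1[OF q1, of 1] by (simp add: power2_eq_square)
  obtain D where D: "D \<ge> 1" "\<And>j. norm (inv_qfact (q\<^sup>2) j) \<le> D"
    using inv_qfact_bounded[OF q2] by blast
  have r1: "norm r < 1"
    using q1 abs_square_less_1[of "norm r"] by (simp add: r2[symmetric] norm_power)
  have "(\<lambda>x. norm (case x of (m, n) \<Rightarrow> summand q r k i m n)) summable_on (UNIV \<times> ({1..k} \<rightarrow>\<^sub>E (UNIV :: nat set)))"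
  proof (rule summable_on_comparison_test)
    show "(\<lambda>x. C * C ^ (k - 1) * D * (case x of (m, n) \<Rightarrow> norm r ^ m * (\<Prod>l=1..k. norm q ^ n l)))
       summable_on (UNIV \<times> ({1..k} \<rightarrow>\<^sub>E (UNIV :: nat set)))"
      using q1 r1 by (intro summable_on_cmult_right geometric_dominated_summable) auto
    fix x :: "nat \<times> (nat \<Rightarrow> nat)" assume "x \<in> UNIV \<times> ({1..k} \<rightarrow>\<^sub>E (UNIV :: nat set))"
    obtain m n where x: "x = (m, n)" by (cases x)
    define E where "E = m * n k + (\<Sum>j=1..k. (tail_sum k n j)\<^sup>2) + (\<Sum>j=i..k. tail_sum k n j)"
    have "(\<Sum>j=1..k. n j) \<le> (\<Sum>j=1..k. (tail_sum k n j)\<^sup>2)"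
    proof (rule sum_mono)
      fix j assume "j \<in> {1..k}"
      then have "n j \<le> tail_sum k n j" by (intro le_tail_sum) auto
      also have "\<dots> \<le> (tail_sum k n j)\<^sup>2" by (simp add: power2_eq_square)
      finally show "n j \<le> (tail_sum k n j)\<^sup>2" .
    qed
    then have "(\<Sum>j=1..k. n j) \<le> E" by (simp add: E_def)
    then have "norm q ^ E \<le> norm q ^ (\<Sum>j=1..k. n j)"
      using q1 by (intro power_decreasing) auto
    then have e1: "norm q ^ E \<le> (\<Prod>l=1..k. norm q ^ n l)" by (simp add: power_sum)
    have e2: "norm r ^ (m\<^sup>2) \<le> norm r ^ m"
      using r1 by (intro power_decreasing) (auto simp: power2_eq_square)
    have e3: "norm (\<Prod>j=1..<k. inv_qfact q (int (n j))) \<le> C ^ (k - 1)"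
    proof -
      have "norm (\<Prod>j=1..<k. inv_qfact q (int (n j))) \<le> (\<Prod>j=1..<k. C)"
        unfolding prod_norm[symmetric] by (intro prod_mono) (auto simp: C)
      then show ?thesis by simp
    qed
    have "summand q r k i m n = (r ^ (m\<^sup>2) * q ^ E) * (inv_qfact q (int m) * (\<Prod>j=1..<k. inv_qfact q (int (n j))) * inv_qfact (q\<^sup>2) (int (n k)))"
      by (simp add: summand_def E_def inv_qfact_of_nat prod_dividef)
    then have "norm (summand q r k i m n) = (norm r ^ (m\<^sup>2) * norm q ^ E) *
       (norm (inv_qfact q (int m)) * norm (\<Prod>j=1..<k. inv_qfact q (int (n j))) * norm (inv_qfact (q\<^sup>2) (int (n k))))"
      by (simp add: norm_mult norm_power)
    also have "\<dots> \<le> (norm r ^ m * (\<Prod>l=1..k. norm q ^ n l)) * (C * C ^ (k - 1) * D)"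
      using C D e1 e2 e3 by (intro mult_mono) (auto intro!: mult_nonneg_nonneg prod_nonneg)
    finally show "norm (case x of (m, n) \<Rightarrow> summand q r k i m n)
        \<le> C * C ^ (k - 1) * D * (case x of (m, n) \<Rightarrow> norm r ^ m * (\<Prod>l=1..k. norm q ^ n l))"
      by (simp add: x mult_ac)
  qed auto
  then show ?thesis by (rule abs_summable_summable)
qed

text \<open>
  Since \<open>r\<^bsup>m\<^sup>2\<^esup> = q\<^bsup>m(m - 1)/2\<^esup> r\<^sup>m\<close>, this is Euler's series with \<open>a = r q\<^bsup>n\<^sub>k\<^esup>\<close>, and
  \<open>(-r q\<^bsup>n\<^esup>; q)\<^sub>\<infinity> = (-r; q)\<^sub>\<infinity> / (-r; q)\<^sub>n\<close>.
\<close>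
lemma summand_sum_m:
  assumes "k \<ge> 1"
  shows "((\<lambda>m. summand q r k i m n) has_sum
     (qpochhammer_inf (- r) q * (q ^ level_weight i 1 (tail_sum k n 1) * chain_term q k (level_weight i) (pentagonal_beta q r) 1 n))) UNIV"
proof -
  define E where "E = (\<Sum>j=1..k. (tail_sum k n j)\<^sup>2) + (\<Sum>j=i..k. tail_sum k n j)"
  define d where "d = (\<Prod>j=1..<k. inv_qfact q (int (n j))) / qpochhammer (q\<^sup>2) (q\<^sup>2) (n k)"
  have s: "summand q r k i m n = q ^ E * d * (q ^ (m choose 2) * (r * q ^ n k) ^ m / qpochhammer q q m)" for m
  proof -
    have "even (m * (m - 1))" by (cases m) auto
    then have "m * (m - 1) = 2 * (m choose 2)" by (simp add: choose_two)
    then have "m\<^sup>2 = 2 * (m choose 2) + m"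
      by (cases m) (simp_all add: power2_eq_square)
    then have "r ^ (m\<^sup>2) = q ^ (m choose 2) * r ^ m"
      by (simp add: power_add power_mult r2)
    then show ?thesis
      by (simp add: summand_def E_def d_def inv_qfact_of_nat prod_dividef power_add power_mult_distrib power_mult mult_ac
          flip: power_mult[of q "n k" m])
  qed
  have r1: "norm r < 1"
    using q1 abs_square_less_1[of "norm r"] by (simp add: r2[symmetric] norm_power)
  have nz: "qpochhammer (- r) q (n k) \<noteq> 0"
    using neg_mult_power_neq_1[OF r1 q1] by (intro qpochhammer_nonzero) auto
  have "q ^ E * d * qpochhammer_inf (- (r * q ^ n k)) q
    = qpochhammer_inf (- r) q * (q ^ level_weight i 1 (tail_sum k n 1) * chain_term q k (level_weight i) (pentagonal_beta q r) 1 n)"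
  proof -
    have "(\<Sum>l=1..k. level_weight i l (tail_sum k n l)) = E"
    proof -
      have "(\<Sum>l=1..k. if i \<le> l then tail_sum k n l else 0) = (\<Sum>l=i..k. tail_sum k n l)"
        using ik by (intro sum.mono_neutral_cong_right) auto
      then show ?thesis by (simp add: level_weight_def sum.distrib E_def)
    qed
    moreover have "(\<Sum>l=1..k. level_weight i l (tail_sum k n l))
       = level_weight i 1 (tail_sum k n 1) + (\<Sum>l=Suc 1..k. level_weight i l (tail_sum k n l))"
      using assms by (rule sum.atLeast_Suc_atMost)
    ultimately have "q ^ level_weight i 1 (tail_sum k n 1) * q ^ (\<Sum>l=Suc 1..k. level_weight i l (tail_sum k n l)) = q ^ E"
      by (simp flip: power_add)
    then show ?thesis
      using nz qpochhammer_inf_split[OF q1, of "- r" "n k"]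
      by (simp add: chain_term_def d_def pentagonal_beta_def mult_ac)
  qed
  then show ?thesis
    unfolding s using has_sum_cmult_right[OF euler_q_exponential[OF q1, of "r * q ^ n k"], of "q ^ E * d"] by simp
qed

lemma chain_sum_total:
  assumes "k \<ge> 1"
    and T: "((\<lambda>n. q ^ level_weight i 1 (tail_sum k n 1) * chain_term q k (level_weight i) (pentagonal_beta q r) 1 n) has_sum T)
           ({1..k} \<rightarrow>\<^sub>E (UNIV :: nat set))"
  shows "((\<lambda>s. q ^ level_weight i 1 s * chain_sum q k (level_weight i) (pentagonal_beta q r) 1 s) has_sum T) UNIV"
proof (rule has_sum_SigmaD)
  let ?G = "\<lambda>n. q ^ level_weight i 1 (tail_sum k n 1) * chain_term q k (level_weight i) (pentagonal_beta q r) 1 n"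
  show "((\<lambda>(s, n). ?G n) has_sum T) (Sigma UNIV (level_set k 1))"
    using T by (subst has_sum_reindex_bij_witness[where i = "\<lambda>n. (tail_sum k n 1, n)" and j = snd
        and T = "{1..k} \<rightarrow>\<^sub>E (UNIV :: nat set)" and h = ?G and s' = T]) (auto simp: level_set_def PiE_iff extensional_def)
  fix s
  have "(\<Sum>n\<in>level_set k 1 s. ?G n) = q ^ level_weight i 1 s * chain_sum q k (level_weight i) (pentagonal_beta q r) 1 s"
    unfolding chain_sum_def sum_distrib_left by (rule sum.cong) (auto simp: level_set_def)
  then show "((\<lambda>n. case (s, n) of (s, n) \<Rightarrow> ?G n) has_sum q ^ level_weight i 1 s * chain_sum q k (level_weight i) (pentagonal_beta q r) 1 s) (level_set k 1 s)"
    by (intro has_sum_finiteI) (auto simp: finite_level_set)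
qed

text \<open>
  The factors \<open>1 / (q; q)\<^bsub>N - s\<^esub>\<close> in the recursion from level \<open>1\<close> to level \<open>0\<close> tend to a constant
  as \<open>N\<close> grows, which leaves the total of the series.
\<close>
lemma chain_sum_tendsto:
  assumes "k \<ge> 1"
    and T: "((\<lambda>s. q ^ level_weight i 1 s * chain_sum q k (level_weight i) (pentagonal_beta q r) 1 s) has_sum T) UNIV"
  shows "chain_sum q k (level_weight i) (pentagonal_beta q r) 0 \<longlonglongrightarrow> T / qpochhammer_inf q q"
proof -
  let ?a = "\<lambda>s. q ^ level_weight i 1 s * chain_sum q k (level_weight i) (pentagonal_beta q r) 1 s"
  obtain C where C: "C \<ge> 1" "\<And>j. norm (inv_qfact q j) \<le> C"
    using inv_qfact_bounded[OF q1] by blast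
  have "(\<lambda>N. infsum (\<lambda>s. inv_qfact q (int N - int s) * ?a s) UNIV) \<longlonglongrightarrow> infsum (\<lambda>s. 1 / qpochhammer_inf q q * ?a s) UNIV"
  proof (rule dominated_convergence_infsum)
    show "(\<lambda>s. C * norm (?a s)) summable_on UNIV"
      using has_sum_imp_summable[OF T] by (intro summable_on_cmult_right) (simp flip: summable_on_iff_abs_summable_on_complex)
    show "norm (inv_qfact q (int N - int s) * ?a s) \<le> C * norm (?a s)" for N s
      unfolding norm_mult[of "inv_qfact _ _"] by (intro mult_right_mono C) auto
    show "(\<lambda>N. inv_qfact q (int N - int s) * ?a s) \<longlonglongrightarrow> 1 / qpochhammer_inf q q * ?a s" for s
      using inv_qfact_tendsto[OF q1, of "- int s"] by (intro tendsto_mult_right) simp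
  qed
  moreover have "infsum (\<lambda>s. inv_qfact q (int N - int s) * ?a s) UNIV = chain_sum q k (level_weight i) (pentagonal_beta q r) 0 N" for N
  proof (rule infsumI, rule has_sum_finite_neutralI)
    show "chain_sum q k (level_weight i) (pentagonal_beta q r) 0 N = (\<Sum>s\<le>N. inv_qfact q (int N - int s) * ?a s)"
      using assms(1) by (simp add: chain_sum_rec mult_ac)
  qed (auto simp: inv_qfact_neg)
  moreover have "infsum (\<lambda>s. 1 / qpochhammer_inf q q * ?a s) UNIV = T / qpochhammer_inf q q"
    using has_sum_cmult_right[OF T, of "1 / qpochhammer_inf q q"] by (auto intro: infsumI)
  ultimately show ?thesis by simp
qed

text \<open>
  The limit of level \<open>0\<close> is expressed in two ways: through the multiple sum, by
  \<open>chain_sum_tendsto\<close>, and through a theta series, by \<open>tendsto_bailey_sum\<close> and the triple product.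
\<close>
lemma summand_has_sum_nonzero:
  assumes k1: "k \<ge> 1"
  shows "((\<lambda>(m, n). summand q r k i m n) has_sum
           (qpochhammer_inf (- r) q *
            (qpochhammer_inf (q ^ i) (r ^ (3 + 4 * k)) *
             qpochhammer_inf (r ^ (3 + 4 * k - 2 * i)) (r ^ (3 + 4 * k)) *
             qpochhammer_inf (r ^ (3 + 4 * k)) (r ^ (3 + 4 * k))) /
            qpochhammer_inf q q))
         (UNIV \<times> ({1..k} \<rightarrow>\<^sub>E (UNIV :: nat set)))"
proof -
  define p where "p = r ^ (3 + 4 * k)"
  define z where "z = q ^ i"
  define \<Theta> where "\<Theta> = qpochhammer_inf z p * qpochhammer_inf (p / z) p * qpochhammer_inf p p"
  let ?P = "{1..k} \<rightarrow>\<^sub>E (UNIV :: nat set)"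
  let ?G = "\<lambda>n. q ^ level_weight i 1 (tail_sum k n 1) * chain_term q k (level_weight i) (pentagonal_beta q r) 1 n"
  have r1: "norm r < 1"
    using q1 abs_square_less_1[of "norm r"] by (simp add: r2[symmetric] norm_power)
  have p1: "norm p < 1"
  proof -
    have "3 + 4 * k = Suc (2 + 4 * k)" by simp
    then show ?thesis unfolding p_def by (simp only: norm_power_lt_1[OF r1])
  qed
  have nz: "p \<noteq> 0" "z \<noteq> 0" using r0 q_nonzero by (simp_all add: p_def z_def)
  have pz: "p / z = r ^ (3 + 4 * k - 2 * i)"
  proof -
    have "p = r ^ (3 + 4 * k - 2 * i) * r ^ (2 * i)"
      using ik unfolding p_def by (simp flip: power_add)
    also have "r ^ (2 * i) = z"
      by (simp only: z_def power_mult r2)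
    finally show ?thesis using nz(2) by simp
  qed
  obtain S where S: "((\<lambda>(m, n). summand q r k i m n) has_sum S) (UNIV \<times> ?P)"
    using summand_summable by (auto simp: summable_on_def)
  then have "((\<lambda>(n, m). summand q r k i m n) has_sum S) (?P \<times> UNIV)"
    by (subst (asm) has_sum_swap) simp
  then have "((\<lambda>n. qpochhammer_inf (- r) q * ?G n) has_sum S) ?P"
    by (rule has_sum_SigmaD) (use summand_sum_m[OF k1] in simp)
  then have scaled: "((\<lambda>n. 1 / qpochhammer_inf (- r) q * (qpochhammer_inf (- r) q * ?G n)) has_sum
      1 / qpochhammer_inf (- r) q * S) ?P"
    by (rule has_sum_cmult_right)
  have rnz: "qpochhammer_inf (- r) q \<noteq> 0"
    by (intro qpochhammer_inf_nonzero neg_mult_power_neq_1 r1 q1)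
  with scaled have "(?G has_sum S / qpochhammer_inf (- r) q) ?P"
    by simp
  then have lim: "chain_sum q k (level_weight i) (pentagonal_beta q r) 0 \<longlonglongrightarrow> S / qpochhammer_inf (- r) q / qpochhammer_inf q q"
    by (intro chain_sum_tendsto chain_sum_total k1)
  have jtp: "((\<lambda>m. theta_coeff p z (- m)) has_sum \<Theta>) UNIV"
  proof -
    have "(theta_coeff p z has_sum \<Theta>) UNIV"
      unfolding \<Theta>_def by (rule jacobi_triple_product[OF p1 nz])
    then show ?thesis
      by (subst has_sum_reindex_bij_witness[where i = uminus and j = uminus and h = "theta_coeff p z" and T = UNIV and s' = \<Theta>]) auto
  qed
  have "bailey_pair q 0 (\<lambda>m. theta_coeff p z (- m)) (chain_sum q k (level_weight i) (pentagonal_beta q r) 0)"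
    using bailey_pair_lower_levels[of 0] by (simp only: p_def z_def pentagonal_coeff_eq_theta_coeff diff_zero le0)
  from tendsto_bailey_sum[OF q1 has_sum_imp_summable[OF jtp] this lim]
  have "\<Theta> = S / qpochhammer_inf (- r) q / qpochhammer_inf q q * (qpochhammer_inf q q)\<^sup>2"
    using jtp has_sum_unique by blast
  then have "S = qpochhammer_inf (- r) q * \<Theta> / qpochhammer_inf q q"
    using rnz qfact_inf_nonzero[OF q1] by (simp add: power2_eq_square)
  then show ?thesis
    using S by (simp only: \<Theta>_def pz) (simp only: p_def z_def)
qed

end

theorem corollary4p2:
  fixes q r :: complex and k i :: nat
  assumes "norm q < 1" and "r\<^sup>2 = q"
    and "k \<ge> 1" and "1 \<le> i" and "i \<le> k + 1"
  shows "((\<lambda>(m, n). summand q r k i m n) has_sum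
           (qpochhammer_inf (- r) q *
            (qpochhammer_inf (q ^ i) (r ^ (3 + 4 * k)) *
             qpochhammer_inf (r ^ (3 + 4 * k - 2 * i)) (r ^ (3 + 4 * k)) *
             qpochhammer_inf (r ^ (3 + 4 * k)) (r ^ (3 + 4 * k))) /
            qpochhammer_inf q q))
         (UNIV \<times> ({1..k} \<rightarrow>\<^sub>E (UNIV :: nat set)))"
proof (cases "r = 0")
  case False
  then show ?thesis
    using summand_has_sum_nonzero assms by blast
next
  case True
  \<comment> \<open>For \<open>r = 0\<close> negative powers of \<open>q\<close> are not available, but only the term with all indices zero
    survives and all products equal \<open>1\<close>.\<close>
  let ?z = "\<lambda>l\<in>{1..k}. 0::nat"
  have one: "qpochhammer_inf 0 p = 1" for p
    by (simp add: qpochhammer_inf_def)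
  have one': "qpochhammer 0 0 n = 1" for n
    by (simp add: qpochhammer_def)
  have ts0: "tail_sum k ?z j = 0" if "1 \<le> j" for j
    using that by (simp add: tail_sum_def)
  have q0: "q = 0" using True assms by simp
  have "((\<lambda>(m, n). summand q r k i m n) has_sum 1) (UNIV \<times> ({1..k} \<rightarrow>\<^sub>E (UNIV :: nat set)))"
  proof (rule has_sum_finite_neutralI[of "{(0, ?z)}"])
    have "(\<Sum>j=1..k. (tail_sum k ?z j)\<^sup>2) = 0" "(\<Sum>j=i..k. tail_sum k ?z j) = 0"
      using assms ts0 by (auto intro!: sum.neutral simp del: One_nat_def)
    then show "1 = sum (\<lambda>(m, n). summand q r k i m n) {(0, ?z)}"
      by (simp add: summand_def True q0 one' del: restrict_apply One_nat_def)
    fix x :: "nat \<times> (nat \<Rightarrow> nat)" assume x: "x \<in> UNIV \<times> ({1..k} \<rightarrow>\<^sub>E (UNIV :: nat set)) - {(0, ?z)}"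
    obtain m n where mn: "x = (m, n)" by (cases x)
    show "(case x of (m, n) \<Rightarrow> summand q r k i m n) = 0"
    proof (cases "m = 0")
      case False
      then show ?thesis by (simp add: mn summand_def True)
    next
      case m0: True
      then have n: "n \<noteq> ?z" "n \<in> {1..k} \<rightarrow>\<^sub>E UNIV" using x mn by auto
      have "\<exists>l\<in>{1..k}. n l > 0"
      proof (rule ccontr)
        assume "\<not> (\<exists>l\<in>{1..k}. n l > 0)"
        then have "n = ?z" using n(2) by (auto simp: fun_eq_iff PiE_iff extensional_def)
        with n(1) show False by contradiction
      qed
      then obtain l where l: "l \<in> {1..k}" "n l > 0" by blast
      have "0 < (tail_sum k n l)\<^sup>2"
        using l le_tail_sum[of l l k n] by auto
      also have "\<dots> \<le> (\<Sum>j=1..k. (tail_sum k n j)\<^sup>2)"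
        using l by (intro member_le_sum) auto
      finally show ?thesis by (simp add: mn summand_def q0)
    qed
  qed auto
  moreover have "3 + 4 * k - 2 * i \<noteq> 0" using assms by simp
  ultimately show ?thesis
    using assms by (simp add: True q0 one power_0_left)
qed

end
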